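(* Let $\lambda_1,\lambda_2>0$ be real constants and let $f=(f_1,f_2):(\Delta,g_\Delta)\to(\Delta,\lambda_1 g_\Delta)\times(\Delta,\lambda_2 g_\Delta)$ be a holomorphic isometry, i.e. $f:\Delta\to\Delta\times\Delta$ is holomorphic and $\lambda_1 f_1^*g_\Delta+\lambda_2 f_2^*g_\Delta=g_\Delta$ on $\Delta$. Then $f$ is one of the following up to reparametrizations: (1) $f(z)=(z,0)$, with $\lambda_1=1$ and $\lambda_2>0$ arbitrary; (2) $f(z)=(0,z)$, with $\lambda_2=1$ and $\lambda_1>0$ arbitrary; (3) $f(z)=(z,z)$, with $\lambda_1+\lambda_2=1$; (4) $f=(\alpha,\beta):\Delta\to\Delta^2$ is the square root embedding, with $\lambda_1=\lambda_2=1$.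
   Context: $\Delta=\{z\in\mathbb{C}:|z|<1\}$ is the unit disk, and $g_\Delta$ is the Poincar\'e metric of constant Gaussian curvature $-2$, with K\"ahler form $-\sqrt{-1}\,\partial\overline{\partial}\log(1-|z|^2)$. Two holomorphic isometries $F,G:(\Delta,g_\Delta)\to(\Delta,\lambda_1 g_\Delta)\times(\Delta,\lambda_2 g_\Delta)$ are equal up to reparametrizations (congruent) if there exist $\phi\in\mathrm{Aut}(\Delta)$ and $\Psi\in\mathrm{Aut}(\Delta\times\Delta)$ (biholomorphic automorphisms) such that $F=\Psi\circ G\circ\phi$. The square root embedding is defined as follows: let $\mathcal{H}=\{\tau\in\mathbb{C}:\mathrm{Im}\,\tau>0\}$ and let $\rho_2:\mathcal{H}\to\mathcal{H}^2$, $\rho_2(\tau)=(\tau^{1/2},\, i\,\tau^{1/2})$, where $\tau^{1/2}=r^{1/2}e^{i\theta/2}$ for $\tau=re^{i\theta}$ with $r>0$, $0<\theta<\pi$; the square root embedding $\Delta\to\Delta^2$ is obtained from $\rho_2$ by composing with a Cayley transform $\Delta\to\mathcal{H}$ in the domain and with the Cayley transform $\mathcal{H}\to\Delta$ in each factor of the target. *)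

theory Defs
  imports "HOL-Complex_Analysis.Complex_Analysis"
begin

abbreviation unit_disk :: "complex set" where
  "unit_disk \<equiv> ball 0 1"

text \<open>
  A Riemannian metric on a domain of the complex plane is a function \<open>g z u v\<close> of a point and two
  tangent vectors. The Kaehler form \<open>- i \<partial>\<partial>' log (1 - |z|^2)\<close> equals
  \<open>i (1 - |z|^2)^(-2) dz \<and> dz'\<close> (primes denoting conjugates), and
  \<open>i h dz \<and> dz' = 2 h dx \<and> dy\<close> is the area form of \<open>2 h (dx^2 + dy^2)\<close>;
  this explains the factor 2 below, which gives Gaussian curvature \<open>-2\<close>.
\<close>

definition poincare_metric :: "complex \<Rightarrow> complex \<Rightarrow> complex \<Rightarrow> real" where
  "poincare_metric z u v = 2 * (u \<bullet> v) / (1 - (cmod z)\<^sup>2)\<^sup>2"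

definition pullback_metric ::
  "('a::real_normed_vector \<Rightarrow> 'b::real_normed_vector) \<Rightarrow> ('b \<Rightarrow> 'b \<Rightarrow> 'b \<Rightarrow> real) \<Rightarrow> 'a \<Rightarrow> 'a \<Rightarrow> 'a \<Rightarrow> real" where
  "pullback_metric f g z u v =
     g (f z) (frechet_derivative f (at z) u) (frechet_derivative f (at z) v)"

definition holomorphic_isometry :: "real \<Rightarrow> real \<Rightarrow> (complex \<Rightarrow> complex \<times> complex) \<Rightarrow> bool" where
  "holomorphic_isometry l1 l2 f \<longleftrightarrow>
     (fst \<circ> f) holomorphic_on unit_disk \<and> (snd \<circ> f) holomorphic_on unit_disk \<and>
     f ` unit_disk \<subseteq> unit_disk \<times> unit_disk \<and>
     (\<forall>z\<in>unit_disk. \<forall>u v.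
        l1 * pullback_metric (fst \<circ> f) poincare_metric z u v +
        l2 * pullback_metric (snd \<circ> f) poincare_metric z u v = poincare_metric z u v)"

definition scaleC2 :: "complex \<Rightarrow> complex \<times> complex \<Rightarrow> complex \<times> complex" where
  "scaleC2 c p = (c * fst p, c * snd p)"

text \<open>Holomorphic maps between domains of \<open>\<complex>\<^sup>2\<close>: the real derivative exists and is complex-linear.\<close>

definition holomorphic2_on ::
  "(complex \<times> complex \<Rightarrow> complex \<times> complex) \<Rightarrow> (complex \<times> complex) set \<Rightarrow> bool" where
  "holomorphic2_on F U \<longleftrightarrow>
     (\<forall>p\<in>U. \<exists>D. (F has_derivative D) (at p within U) \<and> (\<forall>c v. D (scaleC2 c v) = scaleC2 c (D v)))"

text \<open>Automorphisms are total functions of which only the restriction to the domain matters.\<close>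

definition Aut_disk :: "(complex \<Rightarrow> complex) set" where
  "Aut_disk = {\<phi>. \<phi> holomorphic_on unit_disk \<and> \<phi> ` unit_disk \<subseteq> unit_disk \<and>
     (\<exists>\<psi>. \<psi> holomorphic_on unit_disk \<and> \<psi> ` unit_disk \<subseteq> unit_disk \<and>
        (\<forall>z\<in>unit_disk. \<psi> (\<phi> z) = z \<and> \<phi> (\<psi> z) = z))}"

definition Aut_bidisk :: "(complex \<times> complex \<Rightarrow> complex \<times> complex) set" where
  "Aut_bidisk = {\<Psi>. holomorphic2_on \<Psi> (unit_disk \<times> unit_disk) \<and>
     \<Psi> ` (unit_disk \<times> unit_disk) \<subseteq> unit_disk \<times> unit_disk \<and>
     (\<exists>\<Theta>. holomorphic2_on \<Theta> (unit_disk \<times> unit_disk) \<and>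
        \<Theta> ` (unit_disk \<times> unit_disk) \<subseteq> unit_disk \<times> unit_disk \<and>
        (\<forall>p\<in>unit_disk \<times> unit_disk. \<Theta> (\<Psi> p) = p \<and> \<Psi> (\<Theta> p) = p))}"

definition congruent_isometries ::
  "real \<Rightarrow> real \<Rightarrow> (complex \<Rightarrow> complex \<times> complex) \<Rightarrow> (complex \<Rightarrow> complex \<times> complex) \<Rightarrow> bool" where
  "congruent_isometries l1 l2 F G \<longleftrightarrow>
     holomorphic_isometry l1 l2 F \<and> holomorphic_isometry l1 l2 G \<and>
     (\<exists>\<phi>\<in>Aut_disk. \<exists>\<Psi>\<in>Aut_bidisk. \<forall>z\<in>unit_disk. F z = \<Psi> (G (\<phi> z)))"

definition cayley :: "complex \<Rightarrow> complex" where
  "cayley \<tau> = (\<tau> - \<i>) / (\<tau> + \<i>)"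

definition inverse_cayley :: "complex \<Rightarrow> complex" where
  "inverse_cayley z = \<i> * (1 + z) / (1 - z)"

text \<open>\<^const>\<open>inverse_cayley\<close> maps the disk onto the upper half-plane, with inverse \<^const>\<open>cayley\<close>.\<close>

definition rho2 :: "complex \<Rightarrow> complex \<times> complex" where
  "rho2 \<tau> = (csqrt \<tau>, \<i> * csqrt \<tau>)"

text \<open>On the upper half-plane \<^const>\<open>csqrt\<close> is the branch with argument in \<open>(0, pi/2)\<close>:\<close>

lemma csqrt_rcis:
  assumes "0 < r" "0 < \<theta>" "\<theta> < pi"
  shows "csqrt (rcis r \<theta>) = rcis (sqrt r) (\<theta> / 2)"
proof (rule csqrt_unique)
  show "(rcis (sqrt r) (\<theta> / 2))\<^sup>2 = rcis r \<theta>"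
    using assms by (simp add: power2_eq_square rcis_mult)
  have "cos (\<theta> / 2) > 0"
    using assms by (intro cos_gt_zero_pi) auto
  then show "0 < Re (rcis (sqrt r) (\<theta> / 2)) \<or>
      Re (rcis (sqrt r) (\<theta> / 2)) = 0 \<and> 0 \<le> Im (rcis (sqrt r) (\<theta> / 2))"
    using assms by simp
qed

definition square_root_embedding :: "complex \<Rightarrow> complex \<times> complex" where
  "square_root_embedding z = map_prod cayley cayley (rho2 (inverse_cayley z))"

end

theory Submission
  imports Defs
begin

text \<open>
  Automorphisms move any chosen base point and its image to the origin, so assume \<open>f(0) = 0\<close>. Polarizing the isometry
  equation gives \<open>\<Sum> \<kappa>\<^sub>i g\<^sub>i'(z) G\<^sub>i'(w) / (1 - g\<^sub>i(z) G\<^sub>i(w))\<^sup>2 = 0\<close> for the three maps \<open>f\<^sub>1\<close>, \<open>f\<^sub>2\<close>, \<open>id\<close> with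
  weights \<open>\<lambda>\<^sub>1\<close>, \<open>\<lambda>\<^sub>2\<close>, \<open>-1\<close>, where \<open>G(w) = cnj (g (cnj w))\<close>. Let \<open>A = \<lambda>\<^sub>1 |f\<^sub>1'(0)|\<^sup>2\<close> and
  \<open>B = \<lambda>\<^sub>2 |f\<^sub>2'(0)|\<^sup>2\<close>, so that \<open>A + B = 1\<close>. Comparing Taylor coefficients of order at most two in each
  variable, \<open>A = 0\<close> or \<open>B = 0\<close> forces the first two cases, \<open>f\<^sub>1''(0) = 0\<close> forces
  \<open>|f\<^sub>1'(0)| = |f\<^sub>2'(0)| = 1\<close> and hence the third case by Schwarz, and otherwise \<open>A\<close> satisfies a
  polynomial identity with coefficients depending only on \<open>\<lambda>\<^sub>1\<close> and \<open>\<lambda>\<^sub>2\<close>. If the last alternative holds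
  at every base point, then \<open>A\<close> varies over an interval with the base point, so that the identity
  holds for all \<open>A\<close>; this yields \<open>\<lambda>\<^sub>1 = \<lambda>\<^sub>2 = 1\<close>. In that case
  \<open>f\<^sub>1\<close> solves a quadratic equation determined, up to rotations, by \<open>A\<close>. The square root embedding
  attains every value of \<open>A\<close> in \<open>(0, 1)\<close>, so it agrees with \<open>f\<close> after reparametrization.
\<close>

subsection \<open>Self-maps of the disk and the Poincare metric\<close>

definition disk_map :: "(complex \<Rightarrow> complex) \<Rightarrow> bool" where
  "disk_map g \<longleftrightarrow> g holomorphic_on unit_disk \<and> g ` unit_disk \<subseteq> unit_disk"

text \<open>The factor \<open>\<rho>\<close> in \<open>g\<^sup>* ds\<^sup>2 = \<rho> ds\<^sup>2\<close>, where \<open>ds\<^sup>2\<close> is the Poincare metric.\<close>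

definition metric_ratio :: "(complex \<Rightarrow> complex) \<Rightarrow> complex \<Rightarrow> real" where
  "metric_ratio g z = (cmod (deriv g z) * (1 - (cmod z)\<^sup>2) / (1 - (cmod (g z))\<^sup>2))\<^sup>2"

lemma disk_map_norm: "disk_map g \<Longrightarrow> norm z < 1 \<Longrightarrow> norm (g z) < 1"
  unfolding disk_map_def by (auto simp: image_subset_iff)

lemma disk_map_DERIV:
  "disk_map g \<Longrightarrow> norm z < 1 \<Longrightarrow> (g has_field_derivative deriv g z) (at z)"
  unfolding disk_map_def by (auto intro: holomorphic_derivI)

lemma disk_map_comp: "disk_map g \<Longrightarrow> disk_map \<phi> \<Longrightarrow> disk_map (\<lambda>z. g (\<phi> z))"
  unfolding disk_map_def
  using holomorphic_on_compose_gen[of \<phi> unit_disk g unit_disk] by (auto simp: o_def)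

lemma norm_sq_less_1: "norm z < 1 \<Longrightarrow> (norm z)\<^sup>2 < 1"
  by (simp add: abs_square_less_1)

lemma metric_ratio_comp:
  assumes "disk_map g" "disk_map \<phi>" "norm z < 1"
  shows "metric_ratio (\<lambda>z. g (\<phi> z)) z = metric_ratio g (\<phi> z) * metric_ratio \<phi> z"
proof -
  have n: "norm (\<phi> z) < 1" using assms disk_map_norm by blast
  have "((\<lambda>z. g (\<phi> z)) has_field_derivative deriv g (\<phi> z) * deriv \<phi> z) (at z)"
    using DERIV_chain2 disk_map_DERIV assms n by blast
  then have "deriv (\<lambda>z. g (\<phi> z)) z = deriv g (\<phi> z) * deriv \<phi> z"
    by (rule DERIV_imp_deriv)
  then show ?thesis
    using norm_sq_less_1[OF n] unfolding metric_ratio_def power_mult_distrib[symmetric]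
    by (simp add: norm_mult mult.assoc)
qed

lemma metric_ratio_zero: "g 0 = 0 \<Longrightarrow> metric_ratio g 0 = (cmod (deriv g 0))\<^sup>2"
  by (simp add: metric_ratio_def)

lemma continuous_on_ratio:
  assumes "disk_map g"
  shows "continuous_on unit_disk (metric_ratio g)"
proof -
  have "deriv g holomorphic_on unit_disk"
    using assms disk_map_def holomorphic_deriv by blast
  then show ?thesis
    using assms norm_sq_less_1[OF disk_map_norm[OF assms]]
    unfolding metric_ratio_def disk_map_def
    by (intro continuous_intros holomorphic_on_imp_continuous_on) fastforce+
qed

lemma one_minus_cnj_mult_nonzero:
  fixes w z :: complex
  assumes "norm w < 1" "norm z < 1"
  shows "1 - w * z \<noteq> 0"
proof -
  have "norm (w * z) < 1"
    using assms norm_mult_less by fastforce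
  then show ?thesis by auto
qed

lemma disk_map_Moebius: "norm w < 1 \<Longrightarrow> disk_map (Moebius_function 0 w)"
  unfolding disk_map_def
  using Moebius_function_holomorphic Moebius_function_norm_lt_1 by auto

text \<open>The identity \<open>key\<close> evaluates \<open>1 - |m(z)|^2\<close> for the Moebius
  map \<open>m\<close>, and the result equals \<open>|m'(z)| (1 - |z|^2)\<close>: equality in the
  Schwarz-Pick inequality.\<close>

lemma metric_ratio_Moebius:
  assumes "norm w < 1" "norm z < 1"
  shows "metric_ratio (Moebius_function 0 w) z = 1"
proof -
  have nz: "1 - cnj w * z \<noteq> 0"
    using one_minus_cnj_mult_nonzero[of "cnj w" z] assms by simp
  have "((\<lambda>z. (z - w) / (1 - cnj w * z)) has_field_derivative
      (1 - cnj w * w) / (1 - cnj w * z)\<^sup>2) (at z)"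
    using nz by (auto intro!: derivative_eq_intros simp: field_simps power2_eq_square)
  then have d: "deriv (Moebius_function 0 w) z = (1 - cnj w * w) / (1 - cnj w * z)\<^sup>2"
    by (simp add: Moebius_function_simple[abs_def] DERIV_imp_deriv)
  have ww: "1 - cnj w * w = of_real (1 - (cmod w)\<^sup>2)"
    by (simp add: complex_norm_square mult.commute del: of_real_power)
  have w1: "(cmod w)\<^sup>2 < 1" and z1: "(cmod z)\<^sup>2 < 1"
    using assms norm_sq_less_1 by auto
  have key: "(cmod (1 - cnj w * z))\<^sup>2 - (cmod (z - w))\<^sup>2 = (1 - (cmod w)\<^sup>2) * (1 - (cmod z)\<^sup>2)"
    unfolding cmod_power2 by (simp add: algebra_simps power2_eq_square)
  have pos: "(cmod (1 - cnj w * z))\<^sup>2 \<noteq> 0"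
    using nz by simp
  have "(cmod (Moebius_function 0 w z))\<^sup>2 = (cmod (z - w))\<^sup>2 / (cmod (1 - cnj w * z))\<^sup>2"
    unfolding Moebius_function_simple norm_divide power_divide ..
  then have "1 - (cmod (Moebius_function 0 w z))\<^sup>2 =
      (1 - (cmod w)\<^sup>2) * (1 - (cmod z)\<^sup>2) / (cmod (1 - cnj w * z))\<^sup>2"
    unfolding key[symmetric] using pos by (simp only: diff_divide_distrib) simp
  moreover have "cmod (deriv (Moebius_function 0 w) z) = (1 - (cmod w)\<^sup>2) / (cmod (1 - cnj w * z))\<^sup>2"
    unfolding d ww norm_divide norm_of_real norm_power using w1 by simp
  ultimately show ?thesis
    using w1 z1 pos by (simp add: metric_ratio_def)
qed

lemma disk_map_rotation: "norm c \<le> 1 \<Longrightarrow> disk_map (\<lambda>z. c * z)"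
  unfolding disk_map_def
  by (auto intro!: holomorphic_intros simp: norm_mult) (metis mult_le_cancel_right1 mult_mono' norm_ge_zero order_le_less_trans mult_left_le_one_le)

lemma deriv_cmult_id: "deriv (\<lambda>z. c * z) = (\<lambda>z::complex. c)"
  by (rule ext, rule DERIV_imp_deriv) (auto intro!: derivative_eq_intros)

lemma metric_ratio_rotation: "norm c = 1 \<Longrightarrow> norm z < 1 \<Longrightarrow> metric_ratio (\<lambda>z. c * z) z = 1"
  using norm_sq_less_1[of z] by (simp add: metric_ratio_def deriv_cmult_id norm_mult)

text \<open>A complex derivative multiplies the real inner product by \<open>|g'(z)|^2\<close>, so
  each pullback is a pointwise multiple of the Poincare metric. The tensor equation is therefore one
  scalar equation per point, recovered by testing on \<open>u = v = 1\<close>.\<close>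

lemma holomorphic_isometry_iff:
  "holomorphic_isometry l1 l2 f \<longleftrightarrow> disk_map (fst \<circ> f) \<and> disk_map (snd \<circ> f) \<and>
     (\<forall>z\<in>unit_disk. l1 * metric_ratio (fst \<circ> f) z + l2 * metric_ratio (snd \<circ> f) z = 1)"
proof -
  have pb: "pullback_metric g poincare_metric z u v = metric_ratio g z * poincare_metric z u v"
    if "disk_map g" "norm z < 1" for g z u v
  proof -
    have "(g has_derivative (\<lambda>u. deriv g z * u)) (at z)"
      using disk_map_DERIV that by (simp add: has_field_derivative_def)
    then have "frechet_derivative g (at z) = (\<lambda>u. deriv g z * u)"
      using frechet_derivative_at by metis
    moreover have "(deriv g z * u) \<bullet> (deriv g z * v) = (cmod (deriv g z))\<^sup>2 * (u \<bullet> v)"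
      unfolding cmod_power2 inner_complex_def by (simp add: algebra_simps power2_eq_square)
    ultimately show ?thesis
      using norm_sq_less_1[OF that(2)]
      by (simp add: pullback_metric_def poincare_metric_def metric_ratio_def power_divide power_mult_distrib)
  qed
  have pos: "poincare_metric z 1 1 \<noteq> 0" if "norm z < 1" for z
    using norm_sq_less_1[OF that] by (simp add: poincare_metric_def)
  have eqv: "(\<forall>z\<in>unit_disk. \<forall>u v.
        l1 * pullback_metric g poincare_metric z u v +
        l2 * pullback_metric h poincare_metric z u v = poincare_metric z u v) \<longleftrightarrow>
     (\<forall>z\<in>unit_disk. l1 * metric_ratio g z + l2 * metric_ratio h z = 1)" (is "?L \<longleftrightarrow> ?R")
    if "disk_map g" "disk_map h" for g h
  proof
    assume L: ?L
    show ?R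
    proof
      fix z assume z: "z \<in> unit_disk"
      have "(l1 * metric_ratio g z + l2 * metric_ratio h z) * poincare_metric z 1 1 = poincare_metric z 1 1"
        using bspec[OF L z] z pb[OF that(1), of z] pb[OF that(2), of z] by (simp add: algebra_simps)
      then show "l1 * metric_ratio g z + l2 * metric_ratio h z = 1"
        using pos z by simp
    qed
  next
    assume R: ?R
    show ?L
    proof (intro ballI allI)
      fix z u v :: complex assume z: "z \<in> unit_disk"
      have "l1 * pullback_metric g poincare_metric z u v +
        l2 * pullback_metric h poincare_metric z u v =
        (l1 * metric_ratio g z + l2 * metric_ratio h z) * poincare_metric z u v"
        using z pb[OF that(1), of z] pb[OF that(2), of z] by (simp add: algebra_simps)
      then show "l1 * pullback_metric g poincare_metric z u v +
        l2 * pullback_metric h poincare_metric z u v = poincare_metric z u v"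
        using R z by simp
    qed
  qed
  have "f ` unit_disk \<subseteq> unit_disk \<times> unit_disk \<longleftrightarrow>
      (fst \<circ> f) ` unit_disk \<subseteq> unit_disk \<and> (snd \<circ> f) ` unit_disk \<subseteq> unit_disk"
    by (auto simp: image_subset_iff mem_Times_iff)
  then show ?thesis
    using eqv[of "fst \<circ> f" "snd \<circ> f"]
    unfolding holomorphic_isometry_def disk_map_def by blast
qed

section \<open>Automorphisms of the disk and congruence of pairs\<close>

lemma Aut_disk_comp:
  assumes "\<phi> \<in> Aut_disk" "\<psi> \<in> Aut_disk"
  shows "(\<lambda>z. \<phi> (\<psi> z)) \<in> Aut_disk"
proof -
  obtain \<phi>' where \<phi>': "disk_map \<phi>'" "\<forall>z\<in>unit_disk. \<phi>' (\<phi> z) = z \<and> \<phi> (\<phi>' z) = z"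
    using assms(1) unfolding Aut_disk_def disk_map_def by auto
  obtain \<psi>' where \<psi>': "disk_map \<psi>'" "\<forall>z\<in>unit_disk. \<psi>' (\<psi> z) = z \<and> \<psi> (\<psi>' z) = z"
    using assms(2) unfolding Aut_disk_def disk_map_def by auto
  have d: "disk_map \<phi>" "disk_map \<psi>"
    using assms unfolding Aut_disk_def disk_map_def by auto
  have "disk_map (\<lambda>z. \<phi> (\<psi> z))" "disk_map (\<lambda>z. \<psi>' (\<phi>' z))"
    using d \<phi>' \<psi>' disk_map_comp by auto
  moreover have "\<forall>z\<in>unit_disk. \<psi>' (\<phi>' (\<phi> (\<psi> z))) = z \<and> \<phi> (\<psi> (\<psi>' (\<phi>' z))) = z"
    using \<phi>' \<psi>' d disk_map_norm by (metis mem_ball_0)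
  ultimately show ?thesis
    unfolding Aut_disk_def disk_map_def by blast
qed

lemma Aut_disk_inverse:
  assumes "\<phi> \<in> Aut_disk"
  obtains \<psi> where "\<psi> \<in> Aut_disk" "\<And>z. z \<in> unit_disk \<Longrightarrow> \<psi> (\<phi> z) = z"
    "\<And>z. z \<in> unit_disk \<Longrightarrow> \<phi> (\<psi> z) = z"
  using assms unfolding Aut_disk_def by (smt (verit) mem_Collect_eq)

lemma Aut_disk_in: "\<phi> \<in> Aut_disk \<Longrightarrow> z \<in> unit_disk \<Longrightarrow> \<phi> z \<in> unit_disk"
  unfolding Aut_disk_def image_subset_iff by blast

lemma Aut_disk_Moebius: "norm w < 1 \<Longrightarrow> Moebius_function 0 w \<in> Aut_disk"
  using disk_map_Moebius[of w] disk_map_Moebius[of "- w"]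
    Moebius_function_compose[of "- w" w] Moebius_function_compose[of w "- w"]
  unfolding Aut_disk_def disk_map_def
  by (auto intro!: exI[of _ "Moebius_function 0 (- w)"])

lemma Aut_disk_rotation:
  assumes "norm c = 1"
  shows "(\<lambda>z. c * z) \<in> Aut_disk"
proof -
  have "disk_map (\<lambda>z. c * z)" "disk_map (\<lambda>z. inverse c * z)"
    using assms by (auto intro!: disk_map_rotation simp: norm_inverse)
  moreover have "inverse c * (c * z) = z \<and> c * (inverse c * z) = z" for z
    using assms by (cases "c = 0") (auto simp: field_simps)
  ultimately show ?thesis
    unfolding Aut_disk_def disk_map_def by blast
qed

text \<open>Congruence in a restricted form: the automorphism of the bidisk acts on each factor
  separately and does not exchange the factors. \<open>congruent_isometriesI\<close> passes from it
  to general congruence.\<close>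

definition congruent_pair :: "(complex \<Rightarrow> complex) \<Rightarrow> (complex \<Rightarrow> complex) \<Rightarrow> (complex \<Rightarrow> complex) \<Rightarrow> (complex \<Rightarrow> complex) \<Rightarrow> bool" where
  "congruent_pair g h G H \<longleftrightarrow> (\<exists>\<phi>\<in>Aut_disk. \<exists>\<psi>\<in>Aut_disk. \<exists>\<theta>\<in>Aut_disk.
     \<forall>z\<in>unit_disk. g z = \<psi> (G (\<phi> z)) \<and> h z = \<theta> (H (\<phi> z)))"

lemma congruent_pair_trans:
  assumes "congruent_pair g h G H" "congruent_pair G H K L"
  shows "congruent_pair g h K L"
proof -
  obtain \<phi> \<psi> \<theta> where 1: "\<phi>\<in>Aut_disk" "\<psi>\<in>Aut_disk" "\<theta>\<in>Aut_disk"
    "\<forall>z\<in>unit_disk. g z = \<psi> (G (\<phi> z)) \<and> h z = \<theta> (H (\<phi> z))"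
    using assms(1) unfolding congruent_pair_def by blast
  obtain \<phi>' \<psi>' \<theta>' where 2: "\<phi>'\<in>Aut_disk" "\<psi>'\<in>Aut_disk" "\<theta>'\<in>Aut_disk"
    "\<forall>z\<in>unit_disk. G z = \<psi>' (K (\<phi>' z)) \<and> H z = \<theta>' (L (\<phi>' z))"
    using assms(2) unfolding congruent_pair_def by blast
  show ?thesis
    unfolding congruent_pair_def
    using 1 2 Aut_disk_comp[OF 2(1) 1(1)] Aut_disk_comp[OF 1(2) 2(2)] Aut_disk_comp[OF 1(3) 2(3)]
      Aut_disk_in[OF 1(1)]
    by (intro bexI[of _ "\<lambda>z. \<phi>' (\<phi> z)"] bexI[of _ "\<lambda>z. \<psi> (\<psi>' z)"] bexI[of _ "\<lambda>z. \<theta> (\<theta>' z)"]) auto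
qed

lemma congruent_pair_sym:
  assumes "congruent_pair g h G H" "disk_map G" "disk_map H"
  shows "congruent_pair G H g h"
proof -
  obtain \<phi> \<psi> \<theta> where 1: "\<phi>\<in>Aut_disk" "\<psi>\<in>Aut_disk" "\<theta>\<in>Aut_disk"
    "\<forall>z\<in>unit_disk. g z = \<psi> (G (\<phi> z)) \<and> h z = \<theta> (H (\<phi> z))"
    using assms(1) unfolding congruent_pair_def by blast
  obtain \<phi>' where p: "\<phi>' \<in> Aut_disk" "\<And>z. z \<in> unit_disk \<Longrightarrow> \<phi> (\<phi>' z) = z"
    using Aut_disk_inverse[OF 1(1)] by metis
  obtain \<psi>' where q: "\<psi>' \<in> Aut_disk" "\<And>z. z \<in> unit_disk \<Longrightarrow> \<psi>' (\<psi> z) = z"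
    using Aut_disk_inverse[OF 1(2)] by metis
  obtain \<theta>' where r: "\<theta>' \<in> Aut_disk" "\<And>z. z \<in> unit_disk \<Longrightarrow> \<theta>' (\<theta> z) = z"
    using Aut_disk_inverse[OF 1(3)] by metis
  have "G z = \<psi>' (g (\<phi>' z)) \<and> H z = \<theta>' (h (\<phi>' z))" if "z \<in> unit_disk" for z
    using that 1(4) p q r Aut_disk_in[OF p(1) that] disk_map_norm[OF assms(2), of z]
      disk_map_norm[OF assms(3), of z] by auto
  then show ?thesis
    unfolding congruent_pair_def using p q r by blast
qed

lemma map_prod_has_derivative:
  fixes p :: "complex \<times> complex"
  assumes "(f has_field_derivative k) (at (fst p))" "(g has_field_derivative l) (at (snd p))"
  shows "(map_prod f g has_derivative (\<lambda>v. (k * fst v, l * snd v))) (at p within S)"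
proof -
  have "((\<lambda>q. f (fst q)) has_derivative (\<lambda>v. k * fst v)) (at p)"
    using has_derivative_compose[of fst fst p UNIV f "\<lambda>u. k * u"] assms(1)
    by (simp add: has_field_derivative_def bounded_linear_imp_has_derivative bounded_linear_fst)
  moreover have "((\<lambda>q. g (snd q)) has_derivative (\<lambda>v. l * snd v)) (at p)"
    using has_derivative_compose[of snd snd p UNIV g "\<lambda>u. l * u"] assms(2)
    by (simp add: has_field_derivative_def bounded_linear_imp_has_derivative bounded_linear_snd)
  ultimately have "((\<lambda>q. (f (fst q), g (snd q))) has_derivative (\<lambda>v. (k * fst v, l * snd v))) (at p)"
    by (rule has_derivative_Pair)
  then show ?thesis
    unfolding map_prod_def case_prod_unfold by (rule has_derivative_at_withinI)
qed

lemma map_prod_Aut_bidisk: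
  assumes "\<psi> \<in> Aut_disk" "\<theta> \<in> Aut_disk"
  shows "map_prod \<psi> \<theta> \<in> Aut_bidisk"
proof -
  have hol: "holomorphic2_on (map_prod \<psi> \<theta>) (unit_disk \<times> unit_disk)"
    if \<psi>: "\<psi> \<in> Aut_disk" and \<theta>: "\<theta> \<in> Aut_disk" for \<psi> \<theta>
    unfolding holomorphic2_on_def
  proof
    fix p :: "complex \<times> complex" assume p: "p \<in> unit_disk \<times> unit_disk"
    have d: "disk_map \<psi>" "disk_map \<theta>"
      using \<psi> \<theta> unfolding Aut_disk_def disk_map_def by auto
    \<comment> \<open>The derivative acts on each coordinate by a complex multiplication, hence
      commutes with \<open>scaleC2\<close>.\<close>
    have D: "(map_prod \<psi> \<theta> has_derivative
        (\<lambda>v. (deriv \<psi> (fst p) * fst v, deriv \<theta> (snd p) * snd v))) (at p within unit_disk \<times> unit_disk)"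
      using p by (intro map_prod_has_derivative disk_map_DERIV d) (auto simp: mem_Times_iff)
    show "\<exists>D. (map_prod \<psi> \<theta> has_derivative D) (at p within unit_disk \<times> unit_disk) \<and>
             (\<forall>c v. D (scaleC2 c v) = scaleC2 c (D v))"
      using D by (intro exI[of _ "\<lambda>v. (deriv \<psi> (fst p) * fst v, deriv \<theta> (snd p) * snd v)"])
        (simp add: scaleC2_def mult.left_commute)
  qed
  have im: "map_prod \<psi> \<theta> ` (unit_disk \<times> unit_disk) \<subseteq> unit_disk \<times> unit_disk"
    if "\<psi> \<in> Aut_disk" "\<theta> \<in> Aut_disk" for \<psi> \<theta>
    using Aut_disk_in[OF that(1)] Aut_disk_in[OF that(2)] by auto
  obtain \<psi>' where q: "\<psi>' \<in> Aut_disk" "\<And>z. z \<in> unit_disk \<Longrightarrow> \<psi>' (\<psi> z) = z"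
      "\<And>z. z \<in> unit_disk \<Longrightarrow> \<psi> (\<psi>' z) = z"
    using Aut_disk_inverse[OF assms(1)] by metis
  obtain \<theta>' where r: "\<theta>' \<in> Aut_disk" "\<And>z. z \<in> unit_disk \<Longrightarrow> \<theta>' (\<theta> z) = z"
      "\<And>z. z \<in> unit_disk \<Longrightarrow> \<theta> (\<theta>' z) = z"
    using Aut_disk_inverse[OF assms(2)] by metis
  have "\<forall>p\<in>unit_disk \<times> unit_disk. map_prod \<psi>' \<theta>' (map_prod \<psi> \<theta> p) = p \<and>
      map_prod \<psi> \<theta> (map_prod \<psi>' \<theta>' p) = p"
    using q r by auto
  then show ?thesis
    unfolding Aut_bidisk_def
    using hol[OF assms] im[OF assms] hol[OF q(1) r(1)] im[OF q(1) r(1)] by blast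
qed

lemma congruent_isometriesI:
  assumes "holomorphic_isometry l1 l2 f" "holomorphic_isometry l1 l2 G"
    and "congruent_pair (fst \<circ> f) (snd \<circ> f) (fst \<circ> G) (snd \<circ> G)"
  shows "congruent_isometries l1 l2 f G"
proof -
  obtain \<phi> \<psi> \<theta> where 1: "\<phi>\<in>Aut_disk" "\<psi>\<in>Aut_disk" "\<theta>\<in>Aut_disk"
    "\<forall>z\<in>unit_disk. fst (f z) = \<psi> (fst (G (\<phi> z))) \<and> snd (f z) = \<theta> (snd (G (\<phi> z)))"
    using assms(3) unfolding congruent_pair_def by auto
  then have "\<forall>z\<in>unit_disk. f z = map_prod \<psi> \<theta> (G (\<phi> z))"
    by (auto simp: prod_eq_iff)
  then show ?thesis
    unfolding congruent_isometries_def
    using assms(1,2) 1(1) map_prod_Aut_bidisk[OF 1(2,3)] by blast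
qed

subsection \<open>Polarization and Taylor coefficients\<close>

text \<open>The identity theorem applies because the real points of the ball accumulate at the
  origin, for instance along \<open>r / (2 (n + 1))\<close>.\<close>

lemma vanishes_if_vanishes_on_reals:
  assumes "f holomorphic_on ball 0 r" "r > 0"
    and "\<And>t. \<bar>t\<bar> < r \<Longrightarrow> f (complex_of_real t) = 0" and "z \<in> ball 0 r"
  shows "f z = 0"
proof (rule analytic_continuation[of f "ball 0 r" "of_real ` ball 0 r" 0])
  have "(\<lambda>n. complex_of_real (r / 2 * inverse (Suc n))) \<longlonglongrightarrow> of_real (r / 2 * 0)"
    by (intro tendsto_intros LIMSEQ_inverse_real_of_nat)
  moreover have "r / 2 * inverse (Suc n) < r" for n
    using \<open>r > 0\<close> by (simp add: field_simps add_pos_nonneg)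
  ultimately show "0 islimpt complex_of_real ` ball 0 r"
    unfolding islimpt_sequential using \<open>r > 0\<close>
    by (intro exI[of _ "\<lambda>n. complex_of_real (r / 2 * inverse (Suc n))"])
       (auto simp: abs_mult intro!: imageI simp del: of_real_mult of_real_inverse of_real_divide)
qed (use assms in auto)

text \<open>In the coordinates \<open>z = x + \<i> y\<close>, \<open>w = x - \<i> y\<close> the points \<open>w = cnj z\<close> are those
  with real \<open>x\<close> and \<open>y\<close>, and the identity theorem is applied to one variable at a time.\<close>

lemma polarization:
  fixes \<kappa> :: "'i \<Rightarrow> real"
  assumes g: "\<And>i. i \<in> I \<Longrightarrow> disk_map (g i)"
    and iso: "\<And>z. norm z < 1 \<Longrightarrow> (\<Sum>i\<in>I. \<kappa> i * metric_ratio (g i) z) = 0"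
    and z: "norm z < 1/2" and w: "norm w < 1/2"
  shows "(\<Sum>i\<in>I. of_real (\<kappa> i) * (deriv (g i) z * cnj (deriv (g i) (cnj w))) /
            (1 - g i z * cnj (g i (cnj w)))\<^sup>2) = 0"
proof -
  define H where "H z w = (\<Sum>i\<in>I. of_real (\<kappa> i) * (deriv (g i) z * cnj (deriv (g i) (cnj w))) /
            (1 - g i z * cnj (g i (cnj w)))\<^sup>2)" for z w
  \<comment> \<open>On the antidiagonal \<open>w = cnj z\<close> the sum is the isometry equation
    divided by \<open>(1 - |z|^2)^2\<close>.\<close>
  have diag: "H z (cnj z) = 0" if z: "norm z < 1" for z
  proof -
    have z1: "1 - (cmod z)\<^sup>2 \<noteq> 0"
      using norm_sq_less_1[OF z] by simp
    have "H z (cnj z) = (\<Sum>i\<in>I. of_real (\<kappa> i * metric_ratio (g i) z / (1 - (cmod z)\<^sup>2)\<^sup>2))"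
      unfolding H_def
    proof (rule sum.cong[OF refl])
      fix i assume "i \<in> I"
      have "1 - g i z * cnj (g i z) = of_real (1 - (cmod (g i z))\<^sup>2)"
        by (simp add: complex_norm_square del: of_real_power)
      moreover have "deriv (g i) z * cnj (deriv (g i) z) = of_real ((cmod (deriv (g i) z))\<^sup>2)"
        by (simp add: complex_norm_square del: of_real_power)
      ultimately show "of_real (\<kappa> i) * (deriv (g i) z * cnj (deriv (g i) (cnj (cnj z)))) /
            (1 - g i z * cnj (g i (cnj (cnj z))))\<^sup>2 = of_real (\<kappa> i * metric_ratio (g i) z / (1 - (cmod z)\<^sup>2)\<^sup>2)"
        using z1 by (simp add: metric_ratio_def power_divide power_mult_distrib
            del: of_real_power of_real_diff flip: of_real_power)
    qed
    also have "\<dots> = of_real ((\<Sum>i\<in>I. \<kappa> i * metric_ratio (g i) z) / (1 - (cmod z)\<^sup>2)\<^sup>2)"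
      by (simp add: sum_divide_distrib)
    finally show ?thesis
      using iso[OF z] by simp
  qed
  \<comment> \<open>Conjugating both argument and value keeps a function holomorphic, so
    \<open>H\<close> is holomorphic along any pair of holomorphic curves in the disk.\<close>
  have hol: "(\<lambda>s. H (p s) (q s)) holomorphic_on S"
    if p: "p holomorphic_on S" "p ` S \<subseteq> unit_disk" and q: "q holomorphic_on S" "q ` S \<subseteq> unit_disk"
    for p q S
  proof -
    have comp: "(\<lambda>s. f (r s)) holomorphic_on S"
      if "f holomorphic_on unit_disk" "r holomorphic_on S" "r ` S \<subseteq> unit_disk" for f r
      using holomorphic_on_compose_gen[OF that(2,1,3)] by (simp add: o_def)
    have "cnj ` unit_disk = unit_disk"
      by (auto simp: image_cnj_conv_vimage_cnj)
    then have refl: "(\<lambda>w. cnj (f (cnj w))) holomorphic_on unit_disk"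
      if "f holomorphic_on unit_disk" for f
      using holomorphic_on_compose_cnj_cnj[of f unit_disk] that by (simp add: o_def)
    have dg: "g i holomorphic_on unit_disk" "deriv (g i) holomorphic_on unit_disk" if "i \<in> I" for i
      using g[OF that] unfolding disk_map_def by (auto intro: holomorphic_deriv)
    have nz: "1 - g i (p s) * cnj (g i (cnj (q s))) \<noteq> 0" if "i \<in> I" "s \<in> S" for i s
      using that p q disk_map_norm[OF g[OF that(1)], of "p s"]
        disk_map_norm[OF g[OF that(1)], of "cnj (q s)"]
      by (intro one_minus_cnj_mult_nonzero) (simp_all add: image_subset_iff)
    show ?thesis
      unfolding H_def using nz
      by (intro holomorphic_intros comp[OF dg(1) p] comp[OF dg(2) p]
          comp[OF refl[OF dg(1)] q] comp[OF refl[OF dg(2)] q]) auto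
  qed
  \<comment> \<open>The radius 1/2 for \<open>x\<close> and \<open>y\<close> keeps both
    \<open>x + \<i> * y\<close> and \<open>x - \<i> * y\<close> in the disk. In \<open>line\<close>
    the real \<open>x\<close> is fixed and \<open>y\<close> becomes complex; in \<open>plane\<close>
    \<open>x\<close> becomes complex as well.\<close>
  have bnd: "norm (x + \<i> * y) < 1" "norm (x - \<i> * y) < 1" if "norm x < 1/2" "norm y < 1/2" for x y
    using that norm_triangle_ineq[of x "\<i> * y"] norm_triangle_ineq4[of x "\<i> * y"]
    by (simp_all add: norm_mult)
  have line: "H (of_real x + \<i> * y) (of_real x - \<i> * y) = 0" if x: "\<bar>x\<bar> < 1/2" and y: "norm y < 1/2" for x y
  proof (rule vanishes_if_vanishes_on_reals[of "\<lambda>y. H (of_real x + \<i> * y) (of_real x - \<i> * y)" "1/2"])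
    show "(\<lambda>y. H (of_real x + \<i> * y) (of_real x - \<i> * y)) holomorphic_on ball 0 (1/2)"
      using bnd[of "of_real x"] x by (intro hol) (auto intro!: holomorphic_intros)
    fix t :: real assume "\<bar>t\<bar> < 1/2"
    then show "H (of_real x + \<i> * of_real t) (of_real x - \<i> * of_real t) = 0"
      using diag[of "of_real x + \<i> * of_real t"] bnd[of "of_real x" "of_real t"] x by simp
  qed (use y in auto)
  have plane: "H (x + \<i> * y) (x - \<i> * y) = 0" if x: "norm x < 1/2" and y: "norm y < 1/2" for x y
  proof (rule vanishes_if_vanishes_on_reals[of "\<lambda>x. H (x + \<i> * y) (x - \<i> * y)" "1/2"])
    show "(\<lambda>x. H (x + \<i> * y) (x - \<i> * y)) holomorphic_on ball 0 (1/2)"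
      using bnd[of _ y] y by (intro hol) (auto intro!: holomorphic_intros)
  qed (use x y line in auto)
  have "norm ((z + w) / 2) < 1/2" "norm ((z - w) / (2 * \<i>)) < 1/2"
    using z w norm_triangle_ineq[of z w] norm_triangle_ineq4[of z w] 
    by (simp_all add: norm_divide norm_mult)
  from plane[OF this] have "H z w = 0"
    by (simp add: field_simps)
  then show ?thesis
    unfolding H_def .
qed

lemma vanishing_imp_derivative_zero:
  assumes "open S" "\<And>w. w \<in> S \<Longrightarrow> R w = 0" "(R has_field_derivative D) (at w)" "w \<in> S"
  shows "D = (0::complex)"
proof -
  have "((\<lambda>_. 0) has_field_derivative D) (at w)"
    using has_field_derivative_transform_within_open[OF assms(3,1,4), of "\<lambda>_. 0"] assms(2) by auto
  then show ?thesis
    by (rule DERIV_unique[OF _ DERIV_const])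
qed

section \<open>Differentiation of the polarized identity\<close>

lemma DERIV_polarized_factor:
  fixes F F1 :: "complex \<Rightarrow> complex"
  assumes "(F has_field_derivative F1 w) (at w)" "(F1 has_field_derivative f2) (at w)"
    and "1 - c * F w \<noteq> 0"
  shows "((\<lambda>w. F1 w / (1 - c * F w)\<^sup>2) has_field_derivative
     f2 / (1 - c * F w)\<^sup>2 + 2 * c * (F1 w)\<^sup>2 / (1 - c * F w)^3) (at w)"
proof -
  define q where "q = 1 - c * F w"
  have "((\<lambda>w. F1 w / (1 - c * F w)\<^sup>2) has_field_derivative
     (f2 * q\<^sup>2 - F1 w * (2 * q * - (c * F1 w))) / (q\<^sup>2 * q\<^sup>2)) (at w)"
    unfolding q_def using assms(3) by (auto intro!: derivative_eq_intros assms(1,2))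
  moreover have "(f2 * q\<^sup>2 - F1 w * (2 * q * - (c * F1 w))) / (q\<^sup>2 * q\<^sup>2) =
      f2 / q\<^sup>2 + 2 * c * (F1 w)\<^sup>2 / q^3"
    using assms(3) by (simp add: q_def[symmetric] field_simps power2_eq_square power3_eq_cube)
  ultimately show ?thesis
    unfolding q_def by simp
qed

text \<open>The second derivative is taken only at a zero of \<open>F\<close>, where all
  denominators equal 1.\<close>

lemma DERIV_polarized_factor_deriv:
  fixes F F1 F2 :: "complex \<Rightarrow> complex"
  assumes "(F has_field_derivative F1 w) (at w)" "(F1 has_field_derivative F2 w) (at w)"
    and "(F2 has_field_derivative f3) (at w)" and "F w = 0"
  shows "((\<lambda>w. F2 w / (1 - c * F w)\<^sup>2 + 2 * c * (F1 w)\<^sup>2 / (1 - c * F w)^3)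
    has_field_derivative (f3 + 6 * c * F1 w * F2 w + 6 * c\<^sup>2 * (F1 w)^3)) (at w)"
proof -
  have "((\<lambda>w. F2 w / (1 - c * F w)\<^sup>2) has_field_derivative f3 + 2 * c * F1 w * F2 w) (at w)"
    using assms(4) by (auto intro!: derivative_eq_intros assms(1-3) simp: algebra_simps)
  moreover have "((\<lambda>w. 2 * c * (F1 w)\<^sup>2 / (1 - c * F w)^3)
      has_field_derivative 4 * c * F1 w * F2 w + 6 * c\<^sup>2 * (F1 w)^3) (at w)"
    using assms(4) by (auto intro!: derivative_eq_intros assms(1-3)
        simp: algebra_simps power2_eq_square power3_eq_cube)
  ultimately show ?thesis
    by (auto dest: DERIV_add simp: algebra_simps)
qed

text \<open>Counting the identity map as one more member, with weight -1, makes the isometry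
  equation homogeneous, so that all members can be differentiated alike.\<close>

locale null_family =
  fixes I :: "'i set" and g :: "'i \<Rightarrow> complex \<Rightarrow> complex" and \<kappa> :: "'i \<Rightarrow> real"
  assumes disk_map: "\<And>i. i \<in> I \<Longrightarrow> disk_map (g i)"
    and at_0: "\<And>i. i \<in> I \<Longrightarrow> g i 0 = 0"
    and null: "\<And>z. norm z < 1 \<Longrightarrow> (\<Sum>i\<in>I. \<kappa> i * metric_ratio (g i) z) = 0"
begin

abbreviation "d1 i \<equiv> deriv (g i)"
abbreviation "d2 i \<equiv> deriv (deriv (g i))"
abbreviation "d3 i \<equiv> deriv (deriv (deriv (g i)))"

lemma DERIV_g:
  assumes "i \<in> I" "norm z < 1"
  shows "(g i has_field_derivative d1 i z) (at z)"
    "(d1 i has_field_derivative d2 i z) (at z)"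
    "(d2 i has_field_derivative d3 i z) (at z)"
proof -
  have 0: "g i holomorphic_on unit_disk"
    using disk_map assms unfolding disk_map_def by auto
  then have 1: "d1 i holomorphic_on unit_disk" by (auto intro: holomorphic_deriv)
  then have 2: "d2 i holomorphic_on unit_disk" by (auto intro: holomorphic_deriv)
  show "(g i has_field_derivative d1 i z) (at z)"
    "(d1 i has_field_derivative d2 i z) (at z)"
    "(d2 i has_field_derivative d3 i z) (at z)"
    using holomorphic_derivI[OF 0] holomorphic_derivI[OF 1] holomorphic_derivI[OF 2] assms by auto
qed

lemma DERIV_cnj_g:
  assumes "i \<in> I" "norm z < 1"
  shows "((\<lambda>w. cnj (g i (cnj w))) has_field_derivative cnj (d1 i (cnj z))) (at z)"
    "((\<lambda>w. cnj (d1 i (cnj w))) has_field_derivative cnj (d2 i (cnj z))) (at z)"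
    "((\<lambda>w. cnj (d2 i (cnj w))) has_field_derivative cnj (d3 i (cnj z))) (at z)"
  using DERIV_g[OF assms(1), of "cnj z"] assms(2) has_field_derivative_cnj_cnj[of _ _ z]
  by (auto simp: o_def)

text \<open>These are the derivatives of order 0, 1 and 2 in \<open>w\<close>, at
  \<open>w = 0\<close>, of the polarized identity; \<open>z\<close> stays free.\<close>

lemma moments:
  assumes z: "norm z < 1/2"
  shows "(\<Sum>i\<in>I. of_real (\<kappa> i) * d1 i z * cnj (d1 i 0)) = 0"
    and "(\<Sum>i\<in>I. of_real (\<kappa> i) * d1 i z * (cnj (d2 i 0) + 2 * g i z * (cnj (d1 i 0))\<^sup>2)) = 0"
    and "(\<Sum>i\<in>I. of_real (\<kappa> i) * d1 i z * (cnj (d3 i 0) + 6 * g i z * cnj (d1 i 0) * cnj (d2 i 0)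
            + 6 * (g i z)\<^sup>2 * (cnj (d1 i 0))^3)) = 0"
proof -
  let ?F = "\<lambda>i w. cnj (g i (cnj w))" and ?F1 = "\<lambda>i w. cnj (d1 i (cnj w))"
  let ?F2 = "\<lambda>i w. cnj (d2 i (cnj w))"
  define R where "R w = (\<Sum>i\<in>I. of_real (\<kappa> i) * d1 i z * (?F1 i w / (1 - g i z * ?F i w)\<^sup>2))" for w
  define R1 where "R1 w = (\<Sum>i\<in>I. of_real (\<kappa> i) * d1 i z *
      (?F2 i w / (1 - g i z * ?F i w)\<^sup>2 + 2 * g i z * (?F1 i w)\<^sup>2 / (1 - g i z * ?F i w)^3))" for w
  have nz: "1 - g i z * ?F i w \<noteq> 0" if "i \<in> I" "norm w < 1" for i w
    using that z disk_map_norm[OF disk_map[OF that(1)], of z]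
      disk_map_norm[OF disk_map[OF that(1)], of "cnj w"]
    by (intro one_minus_cnj_mult_nonzero) simp_all
  have R: "R w = 0" if "w \<in> ball 0 (1/2)" for w
    using polarization[of I g \<kappa> z w] disk_map null z that unfolding R_def by (simp add: mult.assoc)
  have D: "(R has_field_derivative R1 w) (at w)" if w: "norm w < 1" for w
    unfolding R_def R1_def
  proof (intro DERIV_sum DERIV_cmult)
    fix i assume i: "i \<in> I"
    show "((\<lambda>w. ?F1 i w / (1 - g i z * ?F i w)\<^sup>2) has_field_derivative
        ?F2 i w / (1 - g i z * ?F i w)\<^sup>2 + 2 * g i z * (?F1 i w)\<^sup>2 / (1 - g i z * ?F i w)^3) (at w)"
      using DERIV_cnj_g(1,2)[OF i w] nz[OF i w] by (rule DERIV_polarized_factor)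
  qed
  have R1: "R1 w = 0" if "w \<in> ball 0 (1/2)" for w
    using vanishing_imp_derivative_zero[OF _ R D that] that by simp
  have D1: "(R1 has_field_derivative (\<Sum>i\<in>I. of_real (\<kappa> i) * d1 i z * (cnj (d3 i 0)
            + 6 * g i z * cnj (d1 i 0) * cnj (d2 i 0)
            + 6 * (g i z)\<^sup>2 * (cnj (d1 i 0))^3))) (at 0)"
    unfolding R1_def
  proof (intro DERIV_sum DERIV_cmult)
    fix i assume i: "i \<in> I"
    have zero: "norm (0::complex) < 1" by simp
    show "((\<lambda>w. ?F2 i w / (1 - g i z * ?F i w)\<^sup>2 + 2 * g i z * (?F1 i w)\<^sup>2 / (1 - g i z * ?F i w)^3)
       has_field_derivative (cnj (d3 i 0) + 6 * g i z * cnj (d1 i 0) * cnj (d2 i 0)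
            + 6 * (g i z)\<^sup>2 * (cnj (d1 i 0))^3)) (at 0)"
      using DERIV_polarized_factor_deriv[OF DERIV_cnj_g[OF i zero], of "g i z"] at_0[OF i]
      by (simp add: algebra_simps)
  qed
  show "(\<Sum>i\<in>I. of_real (\<kappa> i) * d1 i z * (cnj (d3 i 0) + 6 * g i z * cnj (d1 i 0) * cnj (d2 i 0)
            + 6 * (g i z)\<^sup>2 * (cnj (d1 i 0))^3)) = 0"
    using vanishing_imp_derivative_zero[OF _ R1 D1, of "ball 0 (1/2)"] by simp
  show "(\<Sum>i\<in>I. of_real (\<kappa> i) * d1 i z * cnj (d1 i 0)) = 0"
    using R[of 0] at_0 by (simp add: R_def mult.assoc cong: sum.cong)
  show "(\<Sum>i\<in>I. of_real (\<kappa> i) * d1 i z * (cnj (d2 i 0) + 2 * g i z * (cnj (d1 i 0))\<^sup>2)) = 0"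
    using R1[of 0] at_0 by (simp add: R1_def mult.assoc cong: sum.cong)
qed

text \<open>Differentiating the three moments in \<open>z\<close> at 0 gives the coefficients of
  order (0,0), (1,0), (2,0), (1,1), (2,1) and (2,2) in \<open>(z, w)\<close>. The polarized identity
  is Hermitian symmetric, so the remaining ones of order at most two are conjugates of
  these.\<close>

lemma taylor_moments:
  shows "(\<Sum>i\<in>I. of_real (\<kappa> i) * (d1 i 0 * cnj (d1 i 0))) = 0"
    and "(\<Sum>i\<in>I. of_real (\<kappa> i) * (d2 i 0 * cnj (d1 i 0))) = 0"
    and "(\<Sum>i\<in>I. of_real (\<kappa> i) * (d3 i 0 * cnj (d1 i 0))) = 0"
    and "(\<Sum>i\<in>I. of_real (\<kappa> i) * (d2 i 0 * cnj (d2 i 0) + 2 * (d1 i 0 * cnj (d1 i 0))\<^sup>2)) = 0"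
    and "(\<Sum>i\<in>I. of_real (\<kappa> i) * (d3 i 0 * cnj (d2 i 0)
            + 6 * d1 i 0 * d2 i 0 * (cnj (d1 i 0))\<^sup>2)) = 0"
    and "(\<Sum>i\<in>I. of_real (\<kappa> i) * (d3 i 0 * cnj (d3 i 0)
            + 18 * (d1 i 0 * cnj (d1 i 0)) * (d2 i 0 * cnj (d2 i 0))
            + 12 * (d1 i 0 * cnj (d1 i 0))^3)) = 0"
proof -
  have zero: "norm (0::complex) < 1" by simp
  note differentiate = vanishing_imp_derivative_zero[of "ball 0 (1/2)"]
  define E0 where "E0 z = (\<Sum>i\<in>I. of_real (\<kappa> i) * (d1 i z * cnj (d1 i 0)))" for z
  define E0' where "E0' z = (\<Sum>i\<in>I. of_real (\<kappa> i) * (d2 i z * cnj (d1 i 0)))" for z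
  define E1 where "E1 z = (\<Sum>i\<in>I. of_real (\<kappa> i) *
    (d1 i z * (cnj (d2 i 0) + 2 * g i z * (cnj (d1 i 0))\<^sup>2)))" for z
  define E1' where "E1' z = (\<Sum>i\<in>I. of_real (\<kappa> i) *
    (d2 i z * (cnj (d2 i 0) + 2 * g i z * (cnj (d1 i 0))\<^sup>2) + 2 * (d1 i z)\<^sup>2 * (cnj (d1 i 0))\<^sup>2))" for z
  define E2 where "E2 z = (\<Sum>i\<in>I. of_real (\<kappa> i) * (d1 i z * (cnj (d3 i 0)
     + 6 * g i z * cnj (d1 i 0) * cnj (d2 i 0) + 6 * (g i z)\<^sup>2 * (cnj (d1 i 0))^3)))" for z
  define E2' where "E2' z = (\<Sum>i\<in>I. of_real (\<kappa> i) * (d2 i z * (cnj (d3 i 0)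
     + 6 * g i z * cnj (d1 i 0) * cnj (d2 i 0) + 6 * (g i z)\<^sup>2 * (cnj (d1 i 0))^3)
     + (6 * (d1 i z)\<^sup>2 * cnj (d1 i 0) * cnj (d2 i 0) + 12 * g i z * (d1 i z)\<^sup>2 * (cnj (d1 i 0))^3)))" for z
  have E: "E0 z = 0" "E1 z = 0" "E2 z = 0" if "z \<in> ball 0 (1/2)" for z
    using moments[of z] that unfolding E0_def E1_def E2_def by (auto simp: mult.assoc)
  have D0: "(E0 has_field_derivative E0' z) (at z)" if z: "norm z < 1" for z
    unfolding E0_def E0'_def
  proof (intro DERIV_sum DERIV_cmult, goal_cases)
    case (1 i)
    from DERIV_g[OF 1 z] show ?case
      by (auto intro!: derivative_eq_intros)
  qed
  have D1: "(E1 has_field_derivative E1' z) (at z)" if z: "norm z < 1" for z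
    unfolding E1_def E1'_def
  proof (intro DERIV_sum DERIV_cmult, goal_cases)
    case (1 i)
    from DERIV_g[OF 1 z] show ?case
      by (auto intro!: derivative_eq_intros simp: algebra_simps power2_eq_square)
  qed
  have D2: "(E2 has_field_derivative E2' z) (at z)" if z: "norm z < 1" for z
    unfolding E2_def E2'_def
  proof (intro DERIV_sum DERIV_cmult, goal_cases)
    case (1 i)
    from DERIV_g[OF 1 z] show ?case
      by (auto intro!: derivative_eq_intros simp: algebra_simps power2_eq_square power3_eq_cube)
  qed
  have E': "E0' z = 0" "E1' z = 0" "E2' z = 0" if "z \<in> ball 0 (1/2)" for z
    using differentiate[OF _ E(1) D0] differentiate[OF _ E(2) D1] differentiate[OF _ E(3) D2] that by auto
  have D0': "(E0' has_field_derivative (\<Sum>i\<in>I. of_real (\<kappa> i) * (d3 i 0 * cnj (d1 i 0)))) (at 0)"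
    unfolding E0'_def
  proof (intro DERIV_sum DERIV_cmult, goal_cases)
    case (1 i)
    from DERIV_g[OF 1 zero] show ?case
      by (auto intro!: derivative_eq_intros simp: at_0[OF 1])
  qed
  have D1': "(E1' has_field_derivative (\<Sum>i\<in>I. of_real (\<kappa> i) * (d3 i 0 * cnj (d2 i 0)
            + 6 * d1 i 0 * d2 i 0 * (cnj (d1 i 0))\<^sup>2))) (at 0)"
    unfolding E1'_def
  proof (intro DERIV_sum DERIV_cmult, goal_cases)
    case (1 i)
    from DERIV_g[OF 1 zero] show ?case
      by (auto intro!: derivative_eq_intros simp: at_0[OF 1] algebra_simps power2_eq_square)
  qed
  have D2': "(E2' has_field_derivative (\<Sum>i\<in>I. of_real (\<kappa> i) * (d3 i 0 * cnj (d3 i 0)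
            + 18 * (d1 i 0 * cnj (d1 i 0)) * (d2 i 0 * cnj (d2 i 0))
            + 12 * (d1 i 0 * cnj (d1 i 0))^3))) (at 0)"
    unfolding E2'_def
  proof (intro DERIV_sum DERIV_cmult, goal_cases)
    case (1 i)
    from DERIV_g[OF 1 zero] show ?case
      by (auto intro!: derivative_eq_intros simp: at_0[OF 1] algebra_simps power2_eq_square power3_eq_cube)
  qed
  show "(\<Sum>i\<in>I. of_real (\<kappa> i) * (d1 i 0 * cnj (d1 i 0))) = 0"
    using E(1)[of 0] by (simp add: E0_def)
  show "(\<Sum>i\<in>I. of_real (\<kappa> i) * (d2 i 0 * cnj (d1 i 0))) = 0"
    using E'(1)[of 0] by (simp add: E0'_def)
  show "(\<Sum>i\<in>I. of_real (\<kappa> i) * (d3 i 0 * cnj (d1 i 0))) = 0"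
    using differentiate[OF _ E'(1) D0'] by simp
  show "(\<Sum>i\<in>I. of_real (\<kappa> i) * (d2 i 0 * cnj (d2 i 0) + 2 * (d1 i 0 * cnj (d1 i 0))\<^sup>2)) = 0"
    using E'(2)[of 0] at_0 by (simp add: E1'_def power_mult_distrib mult.assoc cong: sum.cong)
  show "(\<Sum>i\<in>I. of_real (\<kappa> i) * (d3 i 0 * cnj (d2 i 0)
            + 6 * d1 i 0 * d2 i 0 * (cnj (d1 i 0))\<^sup>2)) = 0"
    using differentiate[OF _ E'(2) D1'] by simp
  show "(\<Sum>i\<in>I. of_real (\<kappa> i) * (d3 i 0 * cnj (d3 i 0)
            + 18 * (d1 i 0 * cnj (d1 i 0)) * (d2 i 0 * cnj (d2 i 0))
            + 12 * (d1 i 0 * cnj (d1 i 0))^3)) = 0"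
    using differentiate[OF _ E'(3) D2'] by simp
qed

end

subsection \<open>Isometric pairs fixing the origin\<close>

definition isometric_pair :: "real \<Rightarrow> real \<Rightarrow> (complex \<Rightarrow> complex) \<Rightarrow> (complex \<Rightarrow> complex) \<Rightarrow> bool" where
  "isometric_pair l1 l2 g h \<longleftrightarrow> disk_map g \<and> disk_map h \<and>
     (\<forall>z. norm z < 1 \<longrightarrow> l1 * metric_ratio g z + l2 * metric_ratio h z = 1)"

lemma isometric_pair_commute: "isometric_pair l1 l2 g h \<longleftrightarrow> isometric_pair l2 l1 h g"
  unfolding isometric_pair_def by (auto simp: add.commute)

lemma lessThan_3: "{..<3::nat} = {0, 1, 2}"
  by auto

lemma disk_map_ident: "disk_map (\<lambda>z. z)"
  using disk_map_rotation[of 1] by simp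

lemma metric_ratio_ident: "norm z < 1 \<Longrightarrow> metric_ratio (\<lambda>z. z) z = 1"
  using metric_ratio_rotation[of 1 z] by simp

lemma zero_if_deriv_zero:
  assumes "\<And>z. norm z < 1/2 \<Longrightarrow> (F has_field_derivative 0) (at z)" "F 0 = 0" "norm z < 1/2"
  shows "F z = (0::complex)"
proof -
  have "\<exists>c. \<forall>z\<in>ball 0 (1/2). F z = c"
  proof (rule has_field_derivative_zero_constant)
    fix z :: complex assume "z \<in> ball 0 (1/2)"
    then show "(F has_field_derivative 0) (at z within ball 0 (1/2))"
      using assms(1)[of z] has_field_derivative_at_within by auto
  qed simp
  then obtain c where "\<And>z. z \<in> ball 0 (1/2) \<Longrightarrow> F z = c"
    by blast
  from this[of z] this[of 0] show ?thesis
    using assms(2,3) by simp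
qed

lemma disk_map_rotation_if_norm_deriv_1:
  assumes "disk_map f" "f 0 = 0" "cmod (deriv f 0) = 1"
  obtains \<alpha> where "norm \<alpha> = 1" "\<And>z. norm z < 1 \<Longrightarrow> f z = \<alpha> * z"
  using Schwarz_Lemma(3)[of f 0] assms disk_map_norm[OF assms(1)] unfolding disk_map_def by auto

locale normalized_pair =
  fixes l1 l2 :: real and g h :: "complex \<Rightarrow> complex"
  assumes isometric: "isometric_pair l1 l2 g h"
    and g_0: "g 0 = 0" and h_0: "h 0 = 0"
begin

abbreviation "a1 \<equiv> deriv g 0"
abbreviation "a2 \<equiv> deriv (deriv g) 0"
abbreviation "a3 \<equiv> deriv (deriv (deriv g)) 0"
abbreviation "b1 \<equiv> deriv h 0"
abbreviation "b2 \<equiv> deriv (deriv h) 0"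
abbreviation "b3 \<equiv> deriv (deriv (deriv h)) 0"

lemma disk_map_g: "disk_map g" and disk_map_h: "disk_map h"
  using isometric unfolding isometric_pair_def by auto

sublocale null_family "{..<3::nat}" "\<lambda>i. if i = 0 then g else if i = 1 then h else (\<lambda>z. z)"
  "\<lambda>i. if i = 0 then l1 else if i = 1 then l2 else - 1"
proof
  fix z :: complex assume z: "norm z < 1"
  then have "l1 * metric_ratio g z + l2 * metric_ratio h z = 1"
    using isometric unfolding isometric_pair_def by blast
  then show "(\<Sum>i<3::nat. (if i = 0 then l1 else if i = 1 then l2 else - 1) *
      metric_ratio (if i = 0 then g else if i = 1 then h else (\<lambda>z. z)) z) = 0"
    unfolding lessThan_3 by (simp add: metric_ratio_ident[OF z])
qed (auto simp: disk_map_g disk_map_h disk_map_ident g_0 h_0)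

lemma deriv_relations:
  assumes "norm z < 1/2"
  shows "l1 * cnj a1 * deriv g z + l2 * cnj b1 * deriv h z = 1"
    and "l1 * deriv g z * (cnj a2 + 2 * g z * (cnj a1)\<^sup>2) +
         l2 * deriv h z * (cnj b2 + 2 * h z * (cnj b1)\<^sup>2) = 2 * z"
  using moments(1,2)[OF assms] unfolding lessThan_3 by (simp_all add: algebra_simps)

text \<open>The first two moments are exact \<open>z\<close>-derivatives, and all functions involved
  vanish at 0. The first relation determines \<open>h\<close> from \<open>g\<close>; the second then
  becomes a quadratic equation for \<open>g z\<close>.\<close>

lemma integrated_relations:
  assumes z: "norm z < 1/2"
  shows "l1 * cnj a1 * g z + l2 * cnj b1 * h z = z"
    and "l1 * (cnj a2 * g z + (cnj a1 * g z)\<^sup>2) + l2 * (cnj b2 * h z + (cnj b1 * h z)\<^sup>2) = z\<^sup>2"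
proof -
  have "l1 * cnj a1 * g z + l2 * cnj b1 * h z - z = 0"
  proof (rule zero_if_deriv_zero[where F = "\<lambda>z. l1 * cnj a1 * g z + l2 * cnj b1 * h z - z", OF _ _ z])
    fix z :: complex assume z: "norm z < 1/2"
    have D: "(g has_field_derivative deriv g z) (at z)" "(h has_field_derivative deriv h z) (at z)"
      using z disk_map_DERIV disk_map_g disk_map_h by auto
    show "((\<lambda>z. l1 * cnj a1 * g z + l2 * cnj b1 * h z - z) has_field_derivative 0) (at z)"
      using deriv_relations(1)[OF z] D by (auto intro!: derivative_eq_intros simp: mult.commute)
  qed (simp add: g_0 h_0)
  then show "l1 * cnj a1 * g z + l2 * cnj b1 * h z = z" by simp
  have "l1 * (cnj a2 * g z + (cnj a1 * g z)\<^sup>2) + l2 * (cnj b2 * h z + (cnj b1 * h z)\<^sup>2) - z\<^sup>2 = 0"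
  proof (rule zero_if_deriv_zero[where F = "\<lambda>z. l1 * (cnj a2 * g z + (cnj a1 * g z)\<^sup>2)
        + l2 * (cnj b2 * h z + (cnj b1 * h z)\<^sup>2) - z\<^sup>2", OF _ _ z])
    fix z :: complex assume z: "norm z < 1/2"
    have D: "(g has_field_derivative deriv g z) (at z)" "(h has_field_derivative deriv h z) (at z)"
      using z disk_map_DERIV disk_map_g disk_map_h by auto
    show "((\<lambda>z. l1 * (cnj a2 * g z + (cnj a1 * g z)\<^sup>2) + l2 * (cnj b2 * h z + (cnj b1 * h z)\<^sup>2) - z\<^sup>2)
        has_field_derivative 0) (at z)"
      using deriv_relations(2)[OF z] D
      by (auto intro!: derivative_eq_intros simp: algebra_simps power2_eq_square)
  qed (simp add: g_0 h_0)
  then show "l1 * (cnj a2 * g z + (cnj a1 * g z)\<^sup>2) + l2 * (cnj b2 * h z + (cnj b1 * h z)\<^sup>2) = z\<^sup>2"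
    by simp
qed

text \<open>The identity map has first derivative 1 and vanishing higher ones; moved to the
  right-hand side, its terms are the constants 1, 2 and 12.\<close>

lemma taylor_relations:
  shows "l1 * (cmod a1)\<^sup>2 + l2 * (cmod b1)\<^sup>2 = 1"
    and "l1 * a2 * cnj a1 + l2 * b2 * cnj b1 = 0"
    and "l1 * a3 * cnj a1 + l2 * b3 * cnj b1 = 0"
    and "l1 * ((cmod a2)\<^sup>2 + 2 * (cmod a1)^4) + l2 * ((cmod b2)\<^sup>2 + 2 * (cmod b1)^4) = 2"
    and "l1 * (a3 * cnj a2 + 6 * (cmod a1)\<^sup>2 * (a2 * cnj a1)) +
         l2 * (b3 * cnj b2 + 6 * (cmod b1)\<^sup>2 * (b2 * cnj b1)) = 0"
    and "l1 * ((cmod a3)\<^sup>2 + 18 * (cmod a1)\<^sup>2 * (cmod a2)\<^sup>2 + 12 * (cmod a1)^6) +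
         l2 * ((cmod b3)\<^sup>2 + 18 * (cmod b1)\<^sup>2 * (cmod b2)\<^sup>2 + 12 * (cmod b1)^6) = 12"
proof -
  note T = taylor_moments[unfolded lessThan_3, simplified]
  have sq: "x * cnj x = of_real ((cmod x)\<^sup>2)" for x
    by (rule complex_norm_square[symmetric])
  have "complex_of_real (l1 * (cmod a1)\<^sup>2 + l2 * (cmod b1)\<^sup>2) = of_real 1"
    using T(1) by (simp add: sq add_diff_eq)
  then show "l1 * (cmod a1)\<^sup>2 + l2 * (cmod b1)\<^sup>2 = 1"
    unfolding of_real_eq_iff .
  show "l1 * a2 * cnj a1 + l2 * b2 * cnj b1 = 0" "l1 * a3 * cnj a1 + l2 * b3 * cnj b1 = 0"
    using T(2,3) by (simp_all add: mult.assoc)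
  have "complex_of_real (l1 * ((cmod a2)\<^sup>2 + 2 * (cmod a1)^4) + l2 * ((cmod b2)\<^sup>2 + 2 * (cmod b1)^4))
      = of_real 2"
    using T(4) by (simp add: sq add_diff_eq flip: power_mult)
  then show "l1 * ((cmod a2)\<^sup>2 + 2 * (cmod a1)^4) + l2 * ((cmod b2)\<^sup>2 + 2 * (cmod b1)^4) = 2"
    unfolding of_real_eq_iff .
  have eq: "6 * (cmod x)\<^sup>2 * (y * cnj x) = 6 * x * y * (cnj x)\<^sup>2" for x y :: complex
    using complex_norm_square[of x] by (simp add: power2_eq_square)
  show "l1 * (a3 * cnj a2 + 6 * (cmod a1)\<^sup>2 * (a2 * cnj a1)) +
         l2 * (b3 * cnj b2 + 6 * (cmod b1)\<^sup>2 * (b2 * cnj b1)) = 0"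
    using T(5) by (simp only: eq)
  have "complex_of_real (l1 * ((cmod a3)\<^sup>2 + 18 * (cmod a1)\<^sup>2 * (cmod a2)\<^sup>2 + 12 * (cmod a1)^6) +
         l2 * ((cmod b3)\<^sup>2 + 18 * (cmod b1)\<^sup>2 * (cmod b2)\<^sup>2 + 12 * (cmod b1)^6)) = of_real 12"
    using T(6) by (simp add: sq add_diff_eq flip: power_mult)
  then show "l1 * ((cmod a3)\<^sup>2 + 18 * (cmod a1)\<^sup>2 * (cmod a2)\<^sup>2 + 12 * (cmod a1)^6) +
         l2 * ((cmod b3)\<^sup>2 + 18 * (cmod b1)\<^sup>2 * (cmod b2)\<^sup>2 + 12 * (cmod b1)^6) = 12"
    unfolding of_real_eq_iff .
qed

text \<open>The second and third relations give \<open>a2 = a3 = 0\<close>, and the fifth then gives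
  \<open>b2 = 0\<close> or \<open>b3 = 0\<close>. Accordingly the fourth or the sixth relation,
  together with \<open>l1 * p = 1\<close>, forces \<open>p = 1\<close>, so the equality case of the
  Schwarz lemma applies to \<open>g\<close>.\<close>

lemma deriv_h_zero:
  assumes pos: "l1 > 0" "l2 > 0" and b1: "b1 = 0"
  obtains \<alpha> where "l1 = 1" "norm \<alpha> = 1" "\<And>z. norm z < 1 \<Longrightarrow> g z = \<alpha> * z \<and> h z = 0"
proof -
  define p where "p = (cmod a1)\<^sup>2"
  have p4: "cmod a1 ^ 4 = p\<^sup>2" "cmod a1 ^ 6 = p^3"
    unfolding p_def by (simp_all flip: power_mult)
  have p: "l1 * p = 1"
    using taylor_relations(1) b1 by (simp add: p_def)
  then have "a1 \<noteq> 0" by (auto simp: p_def)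
  then have a: "a2 = 0" "a3 = 0"
    using taylor_relations(2,3) b1 pos by auto
  have "l1 * (2 * p\<^sup>2) + l2 * (cmod b2)\<^sup>2 = 2"
    using taylor_relations(4) a b1 p4 by simp
  then have 2: "2 * p + l2 * (cmod b2)\<^sup>2 = 2"
    using p by (simp add: power2_eq_square algebra_simps) (metis mult.left_neutral mult.assoc mult.commute)
  have 3: "b3 = 0 \<or> b2 = 0"
    using taylor_relations(5) a b1 pos by simp
  have "l1 * (12 * p^3) + l2 * (cmod b3)\<^sup>2 = 12"
    using taylor_relations(6) a b1 p4 by simp
  moreover have "l1 * (12 * p^3) = (l1 * p) * (12 * p\<^sup>2)"
    by (simp add: power2_eq_square power3_eq_cube)
  ultimately have 4: "12 * p\<^sup>2 + l2 * (cmod b3)\<^sup>2 = 12"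
    using p by simp
  have "p = 1"
  proof (cases "b2 = 0")
    case True
    then show ?thesis using 2 by simp
  next
    case False
    then have "p\<^sup>2 = 1" using 3 4 by simp
    moreover have "p \<ge> 0" by (simp add: p_def)
    ultimately show ?thesis by (simp add: power2_eq_1_iff)
  qed
  then have l1: "l1 = 1" and "cmod a1 = 1"
    using p abs_square_eq_1[of "cmod a1"] by (auto simp: p_def)
  then obtain \<alpha> where \<alpha>: "norm \<alpha> = 1" "\<And>z. norm z < 1 \<Longrightarrow> g z = \<alpha> * z"
    using disk_map_rotation_if_norm_deriv_1 disk_map_g g_0 by metis
  \<comment> \<open>A rotation with weight 1 already uses up the whole metric, so the ratio of
    \<open>h\<close> vanishes and \<open>h\<close> is constant.\<close>
  have "deriv h z = 0" if z: "norm z < 1" for z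
  proof -
    have "deriv g z = deriv (\<lambda>z. \<alpha> * z) z"
      using z \<alpha>(2) by (intro complex_derivative_transform_within_open[of _ unit_disk])
        (use disk_map_g in \<open>auto simp: disk_map_def intro!: holomorphic_intros\<close>)
    then have "metric_ratio g z = metric_ratio (\<lambda>z. \<alpha> * z) z"
      by (simp add: metric_ratio_def \<alpha>(2)[OF z])
    then have "metric_ratio h z = 0"
      using isometric z metric_ratio_rotation[OF \<alpha>(1) z] l1 pos unfolding isometric_pair_def by force
    then show ?thesis
      using norm_sq_less_1[OF z] norm_sq_less_1[OF disk_map_norm[OF disk_map_h z]]
      by (simp add: metric_ratio_def)
  qed
  then have D: "(h has_field_derivative 0) (at z within unit_disk)" if "z \<in> unit_disk" for z
    using that disk_map_DERIV[OF disk_map_h, of z] by (simp add: has_field_derivative_at_within)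
  have "\<exists>c. \<forall>z\<in>unit_disk. h z = c"
    by (rule has_field_derivative_zero_constant[OF convex_ball D])
  then have "h z = 0" if "norm z < 1" for z
    using h_0 that by (metis mem_ball_0 norm_zero zero_less_one)
  then show ?thesis
    using that[OF l1 \<alpha>(1)] \<alpha>(2) by blast
qed

text \<open>With \<open>A = l1 * p\<close> and \<open>B = l2 * q\<close>, the last three Taylor
  relations are multiplied by \<open>A * B\<close>. The second and third relations say that the
  quantities for \<open>h\<close> corresponding to \<open>s\<close> and \<open>r\<close> are
  \<open>- s\<close> and \<open>- r\<close>, so the contributions of both components merge by
  \<open>A + B = 1\<close>.\<close>

lemma nonzero_relations:
  assumes pos: "l1 > 0" "l2 > 0" and nz: "a1 \<noteq> 0" "b1 \<noteq> 0"
  defines "p \<equiv> (cmod a1)\<^sup>2" and "q \<equiv> (cmod b1)\<^sup>2"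
  defines "s \<equiv> l1 * a2 * cnj a1" and "r \<equiv> l1 * a3 * cnj a1"
  shows "(cmod s)\<^sup>2 = 2 * (l1 * p) * (l2 * q) * (1 - l1 * p\<^sup>2 - l2 * q\<^sup>2)"
    and "cmod r * cmod s = 6 * (l1 * p) * (l2 * q) * \<bar>p - q\<bar> * cmod s"
    and "(cmod r)\<^sup>2 + 18 * (cmod s)\<^sup>2 * (p * (l2 * q) + q * (l1 * p)) =
         12 * (l1 * p) * (l2 * q) * (1 - l1 * p^3 - l2 * q^3)"
proof -
  define A B where "A = l1 * p" and "B = l2 * q"
  have AB: "A > 0" "B > 0"
    using pos nz by (simp_all add: A_def B_def p_def q_def)
  have p4: "cmod a1 ^ 4 = p\<^sup>2" "cmod a1 ^ 6 = p^3" "cmod b1 ^ 4 = q\<^sup>2" "cmod b1 ^ 6 = q^3"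
    unfolding p_def q_def by (simp_all flip: power_mult)
  have sum: "A + B = 1"
    using taylor_relations(1) by (simp add: A_def B_def p_def q_def)
  have s': "l2 * b2 * cnj b1 = - s" and r': "l2 * b3 * cnj b1 = - r"
    using taylor_relations(2,3) by (simp_all add: s_def r_def add_eq_0_iff)
  have sq: "A * (l1 * (cmod a2)\<^sup>2) = (cmod s)\<^sup>2" "A * (l1 * (cmod a3)\<^sup>2) = (cmod r)\<^sup>2"
    unfolding s_def r_def A_def p_def using pos
    by (simp_all add: norm_mult power_mult_distrib power2_eq_square)
  have sq': "B * (l2 * (cmod b2)\<^sup>2) = (cmod s)\<^sup>2" "B * (l2 * (cmod b3)\<^sup>2) = (cmod r)\<^sup>2"
    using arg_cong[OF s', of "\<lambda>x. (cmod x)\<^sup>2"] arg_cong[OF r', of "\<lambda>x. (cmod x)\<^sup>2"] pos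
    unfolding B_def q_def
    by (simp_all add: norm_mult power_mult_distrib power2_eq_square mult_ac)
  have "A * B * (l1 * ((cmod a2)\<^sup>2 + 2 * p\<^sup>2) + l2 * ((cmod b2)\<^sup>2 + 2 * q\<^sup>2)) = A * B * 2"
    using taylor_relations(4) p4 by simp
  then have "B * (A * (l1 * (cmod a2)\<^sup>2)) + A * (B * (l2 * (cmod b2)\<^sup>2)) =
      2 * A * B * (1 - l1 * p\<^sup>2 - l2 * q\<^sup>2)"
    by (simp add: algebra_simps)
  moreover have combine: "B * x + A * x = x" for x
    using sum by (metis add.commute distrib_right mult_1)
  ultimately show "(cmod s)\<^sup>2 = 2 * (l1 * p) * (l2 * q) * (1 - l1 * p\<^sup>2 - l2 * q\<^sup>2)"
    unfolding sq sq' by (simp add: A_def B_def)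

  have cA: "complex_of_real A = l1 * (a1 * cnj a1)" "complex_of_real B = l2 * (b1 * cnj b1)"
    unfolding A_def B_def p_def q_def of_real_mult complex_norm_square by auto
  have cross: "A * (l1 * (a3 * cnj a2)) = r * cnj s" "B * (l2 * (b3 * cnj b2)) = r * cnj s"
  proof -
    show "A * (l1 * (a3 * cnj a2)) = r * cnj s"
      unfolding cA r_def s_def by simp
    have "B * (l2 * (b3 * cnj b2)) = (l2 * b3 * cnj b1) * cnj (l2 * b2 * cnj b1)"
      unfolding cA by simp
    then show "B * (l2 * (b3 * cnj b2)) = r * cnj s"
      unfolding s' r' by simp
  qed
  have "l1 * (a3 * cnj a2) + l2 * (b3 * cnj b2) + 6 * (p * s + q * (l2 * b2 * cnj b1)) = 0"
    using taylor_relations(5) by (simp add: p_def q_def s_def algebra_simps)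
  then have "A * B * (l1 * (a3 * cnj a2) + l2 * (b3 * cnj b2) + 6 * (p * s - q * s)) = 0"
    unfolding s' by simp
  then have "B * (A * (l1 * (a3 * cnj a2))) + A * (B * (l2 * (b3 * cnj b2))) = - (6 * A * B * (p - q) * s)"
    by (simp add: algebra_simps add_eq_0_iff)
  moreover have "B * (r * cnj s) + A * (r * cnj s) = r * cnj s"
    using sum by (metis add.commute distrib_right mult_1 of_real_1 of_real_add)
  ultimately have "r * cnj s = - (6 * A * B * (p - q) * s)"
    unfolding cross by simp
  then have "cmod r * cmod s = cmod (- (6 * A * B * (p - q) * s))"
    by (metis complex_mod_cnj norm_mult)
  also have "\<dots> = 6 * A * B * \<bar>p - q\<bar> * cmod s"
    using AB by (simp add: norm_mult flip: of_real_diff)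
  finally show "cmod r * cmod s = 6 * (l1 * p) * (l2 * q) * \<bar>p - q\<bar> * cmod s"
    by (simp add: A_def B_def)

  have "A * B * (l1 * ((cmod a3)\<^sup>2 + 18 * p * (cmod a2)\<^sup>2 + 12 * p^3) +
         l2 * ((cmod b3)\<^sup>2 + 18 * q * (cmod b2)\<^sup>2 + 12 * q^3)) = A * B * 12"
    using taylor_relations(6)[unfolded p4, folded p_def q_def] by simp
  then have "B * (A * (l1 * (cmod a3)\<^sup>2)) + A * (B * (l2 * (cmod b3)\<^sup>2))
     + 18 * (p * B * (A * (l1 * (cmod a2)\<^sup>2)) + q * A * (B * (l2 * (cmod b2)\<^sup>2))) =
      12 * A * B * (1 - l1 * p^3 - l2 * q^3)"
    by (simp add: algebra_simps)
  then have "(B * (cmod r)\<^sup>2 + A * (cmod r)\<^sup>2) + 18 * (cmod s)\<^sup>2 * (p * B + q * A) =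
      12 * A * B * (1 - l1 * p^3 - l2 * q^3)"
    unfolding sq sq' by (simp add: algebra_simps)
  then show "(cmod r)\<^sup>2 + 18 * (cmod s)\<^sup>2 * (p * (l2 * q) + q * (l1 * p)) =
         12 * (l1 * p) * (l2 * q) * (1 - l1 * p^3 - l2 * q^3)"
    unfolding combine by (simp add: A_def B_def)
qed

text \<open>The numbers \<open>l1 * p\<close> and \<open>l2 * q\<close> are probability weights for
  the values \<open>p\<close> and \<open>q\<close>. Since \<open>s = 0\<close>, the mean is 1 and
  the second moment is at most 1, the latter because \<open>(cmod r)\<^sup>2\<close> is nonnegative.
  The variance is thus zero and \<open>p = q = 1\<close>.\<close>

lemma second_deriv_zero:
  assumes pos: "l1 > 0" "l2 > 0" and nz: "a1 \<noteq> 0" "b1 \<noteq> 0" and a2: "a2 = 0"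
  obtains \<alpha> \<beta> where "l1 + l2 = 1" "norm \<alpha> = 1" "norm \<beta> = 1"
    "\<And>z. norm z < 1 \<Longrightarrow> g z = \<alpha> * z \<and> h z = \<beta> * z"
proof -
  define p q where "p = (cmod a1)\<^sup>2" and "q = (cmod b1)\<^sup>2"
  have pq: "p > 0" "q > 0" using nz by (auto simp: p_def q_def)
  have 1: "l1 * p + l2 * q = 1"
    using taylor_relations(1) by (simp add: p_def q_def)
  have 2: "l1 * p\<^sup>2 + l2 * q\<^sup>2 = 1"
    using nonzero_relations(1)[OF pos nz] a2 pos pq unfolding p_def[symmetric] q_def[symmetric] by simp
  have "12 * (l1 * p) * (l2 * q) * (1 - l1 * p^3 - l2 * q^3) \<ge> 0"
  proof -
    have "(cmod (l1 * a3 * cnj a1))\<^sup>2 = 12 * (l1 * p) * (l2 * q) * (1 - l1 * p^3 - l2 * q^3)"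
      using nonzero_relations(3)[OF pos nz] a2 unfolding p_def[symmetric] q_def[symmetric] by simp
    then show ?thesis
      by (metis zero_le_power2)
  qed
  moreover have "12 * (l1 * p) * (l2 * q) > 0"
    using pos pq by simp
  ultimately have "1 - l1 * p^3 - l2 * q^3 \<ge> 0"
    by (metis linorder_not_less mult_pos_neg)
  moreover have "l1 * p * (p - 1)\<^sup>2 + l2 * q * (q - 1)\<^sup>2 =
     (l1 * p^3 + l2 * q^3) - 2 * (l1 * p\<^sup>2 + l2 * q\<^sup>2) + (l1 * p + l2 * q)"
    by (simp add: algebra_simps power2_eq_square power3_eq_cube)
  ultimately have "l1 * p * (p - 1)\<^sup>2 + l2 * q * (q - 1)\<^sup>2 \<le> 0"
    using 1 2 by simp
  moreover have "l1 * p * (p - 1)\<^sup>2 \<ge> 0" "l2 * q * (q - 1)\<^sup>2 \<ge> 0"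
    using pos pq by simp_all
  ultimately have "l1 * p * (p - 1)\<^sup>2 = 0" "l2 * q * (q - 1)\<^sup>2 = 0"
    by linarith+
  then have "p = 1" "q = 1"
    using pos pq by simp_all
  then have "cmod a1 = 1" "cmod b1 = 1" and l: "l1 + l2 = 1"
    using 1 abs_square_eq_1[of "cmod a1"] abs_square_eq_1[of "cmod b1"] by (auto simp: p_def q_def)
  with disk_map_rotation_if_norm_deriv_1[OF disk_map_g g_0] disk_map_rotation_if_norm_deriv_1[OF disk_map_h h_0]
  obtain \<alpha> \<beta> where "norm \<alpha> = 1" "norm \<beta> = 1" "\<And>z. norm z < 1 \<Longrightarrow> g z = \<alpha> * z"
    "\<And>z. norm z < 1 \<Longrightarrow> h z = \<beta> * z"
    by metis
  then show ?thesis
    using that[OF l] by blast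
qed

text \<open>As \<open>s\<close> is nonzero, the second of the \<open>nonzero_relations\<close> gives
  \<open>|r| = 6 A B |p - q|\<close>. Inserting this and the value of \<open>|s|^2\<close> into the
  third and cancelling \<open>12 * A * B\<close> leaves an identity free of higher
  derivatives.\<close>

lemma second_deriv_nonzero:
  assumes pos: "l1 > 0" "l2 > 0" and nz: "a1 \<noteq> 0" "b1 \<noteq> 0" and a2: "a2 \<noteq> 0"
  defines "p \<equiv> (cmod a1)\<^sup>2" and "q \<equiv> (cmod b1)\<^sup>2"
  shows "3 * (l1 * p) * (l2 * q) * (p - q)\<^sup>2
    + 3 * (1 - l1 * p\<^sup>2 - l2 * q\<^sup>2) * (p * (l2 * q) + q * (l1 * p)) + l1 * p^3 + l2 * q^3 = 1"
proof -
  define A B where "A = l1 * p" and "B = l2 * q"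
  define W where "W = 1 - l1 * p\<^sup>2 - l2 * q\<^sup>2"
  have AB: "A > 0" "B > 0"
    using pos nz by (simp_all add: A_def B_def p_def q_def)
  let ?s = "cmod (l1 * a2 * cnj a1)" and ?r = "cmod (l1 * a3 * cnj a1)"
  note N = nonzero_relations[OF pos nz, folded p_def q_def, folded A_def B_def]
  have "?s \<noteq> 0" using pos nz a2 by simp
  then have "?r = 6 * A * B * \<bar>p - q\<bar>"
    using N(2) by simp
  then have "?r\<^sup>2 = 36 * A * A * B * B * (p - q)\<^sup>2"
    by (simp add: power_mult_distrib power2_eq_square)
  then have "36 * A * A * B * B * (p - q)\<^sup>2 + 18 * (2 * A * B * W) * (p * B + q * A) =
      12 * A * B * (1 - l1 * p^3 - l2 * q^3)"
    using N(3) N(1) unfolding W_def by simp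
  then have "12 * A * B * (3 * A * B * (p - q)\<^sup>2 + 3 * W * (p * B + q * A)) =
      12 * A * B * (1 - l1 * p^3 - l2 * q^3)"
    by (simp add: algebra_simps)
  then have "3 * A * B * (p - q)\<^sup>2 + 3 * W * (p * B + q * A) = 1 - l1 * p^3 - l2 * q^3"
    using AB by simp
  then show ?thesis
    unfolding A_def B_def W_def by simp
qed

end

subsection \<open>Uniqueness and normalization\<close>

lemma disk_map_eqI:
  assumes g: "disk_map g" and h: "disk_map h" and "r > 0"
    and eq: "\<And>z. norm z < r \<Longrightarrow> norm z < 1 \<Longrightarrow> c * g z = d * h z" and "norm z < 1" and "c \<noteq> 0"
  shows "g z = d / c * h z"
proof -
  have "c * g z = d * h z"
  proof (rule analytic_continuation_open[of "ball 0 (min r 1)" unit_disk "\<lambda>z. c * g z" "\<lambda>z. d * h z"])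
    show "(\<lambda>z. c * g z) holomorphic_on unit_disk" "(\<lambda>z. d * h z) holomorphic_on unit_disk"
      using g h unfolding disk_map_def by (auto intro: holomorphic_intros)
  qed (use assms in auto)
  then show ?thesis
    using \<open>c \<noteq> 0\<close> by (simp add: field_simps)
qed

text \<open>The data in \<open>d1\<close> and \<open>d2\<close> do not change under rotations of the
  targets, the only freedom left in the conclusion. They fix the coefficients of a quadratic
  equation for \<open>g\<close>, and \<open>h\<close> then follows from the first integrated
  relation.\<close>

lemma normalized_pair_unique:
  assumes 1: "normalized_pair 1 1 g h" and 2: "normalized_pair 1 1 G H"
    and nz: "deriv g 0 \<noteq> 0" "deriv h 0 \<noteq> 0" "deriv (deriv g) 0 \<noteq> 0"
    and d1: "cmod (deriv G 0) = cmod (deriv g 0)"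
    and d2: "deriv (deriv G) 0 * cnj (deriv G 0) = deriv (deriv g) 0 * cnj (deriv g 0)"
  obtains \<alpha> \<beta> where "norm \<alpha> = 1" "norm \<beta> = 1"
    "\<And>z. norm z < 1 \<Longrightarrow> g z = \<alpha> * G z \<and> h z = \<beta> * H z"
proof -
  interpret g: normalized_pair 1 1 g h by fact
  interpret G: normalized_pair 1 1 G H by fact
  define A B where "A = (cmod (deriv g 0))\<^sup>2" and "B = (cmod (deriv h 0))\<^sup>2"
  define s where "s = deriv (deriv g) 0 * cnj (deriv g 0)"
  have AB1: "A + B = 1" "A + (cmod (deriv H 0))\<^sup>2 = 1"
    using g.taylor_relations(1) G.taylor_relations(1) d1 by (simp_all add: A_def B_def)
  then have AB: "A + B = 1" "(cmod (deriv H 0))\<^sup>2 = B"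
    by linarith+
  then have d1': "cmod (deriv H 0) = cmod (deriv h 0)"
    unfolding B_def by (metis power2_eq_iff_nonneg norm_ge_zero)
  define U V where "U z = cnj (deriv g 0) * g z" and "V z = cnj (deriv G 0) * G z" for z
  \<comment> \<open>\<open>U\<close> and \<open>V\<close> solve the same quadratic equation over \<open>\<complex>[z]\<close>, whose coefficients depend only on
    \<open>A\<close> and \<open>s\<close>; since \<open>s \<noteq> 0\<close>, only one of its two solutions vanishes at the origin.\<close>
  have quadratic: "cnj s * (cnj (deriv f 0) * f z - A * z) +
      2 * A * B * ((cnj (deriv f 0) * f z)\<^sup>2 - z * (cnj (deriv f 0) * f z)) = 0"
    if z: "norm z < 1/2" and fk: "normalized_pair 1 1 f k" and A: "(cmod (deriv f 0))\<^sup>2 = A"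
      and B: "(cmod (deriv k 0))\<^sup>2 = B" and s: "deriv (deriv f) 0 * cnj (deriv f 0) = s"
    for f k :: "complex \<Rightarrow> complex" and z :: complex
  proof -
    interpret f: normalized_pair 1 1 f k by fact
    define u v where "u = cnj (deriv f 0) * f z" and "v = cnj (deriv k 0) * k z"
    have v: "v = z - u"
      using f.integrated_relations(1)[OF z] by (simp add: u_def v_def algebra_simps)
    have s2: "deriv (deriv k) 0 * cnj (deriv k 0) = - s"
      using f.taylor_relations(2) s by (simp add: add_eq_0_iff)
    have cA: "complex_of_real A = deriv f 0 * cnj (deriv f 0)"
      "complex_of_real B = deriv k 0 * cnj (deriv k 0)"
      unfolding A[symmetric] B[symmetric] complex_norm_square by auto
    have "A * (cnj (deriv (deriv f) 0) * f z) = cnj (deriv (deriv f) 0 * cnj (deriv f 0)) * u"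
      "B * (cnj (deriv (deriv k) 0) * k z) = cnj (deriv (deriv k) 0 * cnj (deriv k 0)) * v"
      unfolding cA u_def v_def by (simp_all add: algebra_simps)
    then have *: "A * (cnj (deriv (deriv f) 0) * f z) = cnj s * u"
      "B * (cnj (deriv (deriv k) 0) * k z) = - (cnj s * v)"
      unfolding s s2 by simp_all
    have "A * B * ((cnj (deriv (deriv f) 0) * f z + u\<^sup>2) + (cnj (deriv (deriv k) 0) * k z + v\<^sup>2)) = A * B * z\<^sup>2"
      using f.integrated_relations(2)[OF z] by (simp add: u_def v_def)
    then have "B * (A * (cnj (deriv (deriv f) 0) * f z)) + A * (B * (cnj (deriv (deriv k) 0) * k z))
        + A * B * (u\<^sup>2 + v\<^sup>2 - z\<^sup>2) = 0"
      by (simp add: algebra_simps)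
    then have E: "cnj s * (B * u - A * v) + A * B * (u\<^sup>2 + v\<^sup>2 - z\<^sup>2) = 0"
      unfolding * by (simp add: algebra_simps)
    have "A + B = (1 :: complex)"
      using AB(1) by (metis of_real_1 of_real_add)
    moreover have "B * u - A * v = (A + B) * u - A * z"
      unfolding v by (simp add: algebra_simps)
    ultimately have lin: "B * u - A * v = u - A * z"
      by simp
    have quad: "u\<^sup>2 + v\<^sup>2 - z\<^sup>2 = 2 * (u\<^sup>2 - z * u)"
      unfolding v by (simp add: power2_eq_square algebra_simps)
    show ?thesis
      using E unfolding u_def[symmetric] lin quad by (simp only: mult_ac of_real_mult of_real_numeral)
  qed
  have prod: "(U z - V z) * (cnj s + 2 * A * B * (U z + V z - z)) = 0" if z: "norm z < 1/2" for z
  proof -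
    have "cnj s * (U z - A * z) + 2 * A * B * ((U z)\<^sup>2 - z * U z) = 0"
      unfolding U_def by (rule quadratic[OF z 1]) (simp_all add: A_def B_def s_def)
    moreover have "cnj s * (V z - A * z) + 2 * A * B * ((V z)\<^sup>2 - z * V z) = 0"
      unfolding V_def by (rule quadratic[OF z 2]) (simp_all add: A_def AB(2) s_def d1 d2)
    ultimately have "cnj s * (U z - A * z) + 2 * A * B * ((U z)\<^sup>2 - z * U z) -
       (cnj s * (V z - A * z) + 2 * A * B * ((V z)\<^sup>2 - z * V z)) = 0"
      by simp
    then show ?thesis
      by (simp add: algebra_simps power2_eq_square)
  qed
  \<comment> \<open>At the origin the second factor in \<open>prod\<close> equals
    \<open>cnj s\<close>, which is nonzero; by continuity it stays nonzero nearby, where therefore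
    \<open>U = V\<close>.\<close>
  have "isCont (\<lambda>z. cnj s + 2 * A * B * (U z + V z - z)) 0"
    using disk_map_DERIV[OF g.disk_map_g, of 0] disk_map_DERIV[OF G.disk_map_g, of 0]
    unfolding U_def V_def by (intro continuous_intros) (auto intro: DERIV_isCont)
  moreover have "cnj s + 2 * A * B * (U 0 + V 0 - 0) \<noteq> 0"
    using nz by (simp add: U_def V_def g.g_0 G.g_0 s_def)
  ultimately obtain \<epsilon> where \<epsilon>: "\<epsilon> > 0"
    "\<And>z. dist 0 z < \<epsilon> \<Longrightarrow> cnj s + 2 * A * B * (U z + V z - z) \<noteq> 0"
    using continuous_at_avoid[of 0 "\<lambda>z. cnj s + 2 * A * B * (U z + V z - z)" 0] by auto
  have UV: "U z = V z" if "norm z < min \<epsilon> (1/2)" for z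
    using prod[of z] \<epsilon>(2)[of z] that by simp
  have g: "g z = cnj (deriv G 0) / cnj (deriv g 0) * G z" if "norm z < 1" for z
    using UV \<epsilon>(1) nz
    by (intro disk_map_eqI[OF g.disk_map_g G.disk_map_g _ _ that, of "min \<epsilon> (1/2)"])
       (auto simp: U_def V_def)
  have h: "h z = cnj (deriv H 0) / cnj (deriv h 0) * H z" if "norm z < 1" for z
  proof (rule disk_map_eqI[OF g.disk_map_h G.disk_map_h _ _ that, of "min \<epsilon> (1/2)"])
    fix z :: complex assume z: "norm z < min \<epsilon> (1/2)"
    then have "norm z < 1/2" by simp
    from g.integrated_relations(1)[OF this] G.integrated_relations(1)[OF this] UV[OF z]
    show "cnj (deriv h 0) * h z = cnj (deriv H 0) * H z"
      unfolding U_def V_def by (metis add_left_cancel mult_1 of_real_1)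
  qed (use \<epsilon>(1) nz in auto)
  have n: "norm (cnj (deriv G 0) / cnj (deriv g 0)) = 1" "norm (cnj (deriv H 0) / cnj (deriv h 0)) = 1"
    using d1 d1' nz by (simp_all add: norm_divide)
  show ?thesis
    using that[OF n] g h by blast
qed

section \<open>Moving a base point to the origin\<close>

lemma isometric_pair_comp:
  assumes "isometric_pair l1 l2 g h" "disk_map \<phi>" "\<And>z. norm z < 1 \<Longrightarrow> metric_ratio \<phi> z = 1"
  shows "isometric_pair l1 l2 (\<lambda>z. g (\<phi> z)) (\<lambda>z. h (\<phi> z))"
  using assms unfolding isometric_pair_def by (simp add: disk_map_comp metric_ratio_comp disk_map_norm)

text \<open>The inner map carries 0 to \<open>z0\<close> and the outer one carries
  \<open>g z0\<close> to 0, so the result fixes the origin. Both are isometries, hence the metric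
  ratio of \<open>g\<close> at \<open>z0\<close> becomes the squared modulus of a derivative at
  0.\<close>

definition normalize_at :: "complex \<Rightarrow> (complex \<Rightarrow> complex) \<Rightarrow> complex \<Rightarrow> complex" where
  "normalize_at z0 g = (\<lambda>z. Moebius_function 0 (g z0) (g (Moebius_function 0 (- z0) z)))"

lemma Moebius_function_minus_0 [simp]: "Moebius_function 0 (- z0) 0 = z0"
  by (simp add: Moebius_function_of_zero)

lemma disk_map_normalize_at:
  assumes g: "disk_map g" and z0: "norm z0 < 1"
  shows "disk_map (normalize_at z0 g)"
proof -
  have "norm (g z0) < 1" "norm (- z0) < 1"
    using disk_map_norm[OF g z0] z0 by auto
  then show ?thesis
    unfolding normalize_at_def using g by (intro disk_map_comp[OF disk_map_Moebius disk_map_comp] disk_map_Moebius)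
qed

lemma metric_ratio_normalize_at:
  assumes g: "disk_map g" and z0: "norm z0 < 1" and z: "norm z < 1"
  shows "metric_ratio (normalize_at z0 g) z = metric_ratio g (Moebius_function 0 (- z0) z)"
proof -
  let ?m = "Moebius_function 0 (- z0)"
  have w: "norm (g z0) < 1" "norm (- z0) < 1"
    using disk_map_norm[OF g z0] z0 by auto
  have m: "disk_map ?m" "norm (?m z) < 1"
    using disk_map_Moebius[OF w(2)] disk_map_norm[OF disk_map_Moebius[OF w(2)] z] by auto
  have "metric_ratio (normalize_at z0 g) z = metric_ratio (Moebius_function 0 (g z0)) (g (?m z)) * metric_ratio (\<lambda>z. g (?m z)) z"
    unfolding normalize_at_def
    by (rule metric_ratio_comp[OF disk_map_Moebius[OF w(1)] disk_map_comp[OF g m(1)] z])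
  also have "\<dots> = metric_ratio g (?m z) * metric_ratio ?m z"
    by (simp only: metric_ratio_Moebius[OF w(1) disk_map_norm[OF g m(2)]] metric_ratio_comp[OF g m(1) z] mult_1)
  also have "\<dots> = metric_ratio g (?m z)"
    by (simp only: metric_ratio_Moebius[OF w(2) z] mult_1_right)
  finally show ?thesis .
qed

lemma normalized_pair_normalize_at:
  assumes gh: "isometric_pair l1 l2 g h" and z0: "norm z0 < 1"
  shows "normalized_pair l1 l2 (normalize_at z0 g) (normalize_at z0 h)"
proof
  have d: "disk_map g" "disk_map h"
    using gh unfolding isometric_pair_def by auto
  show "isometric_pair l1 l2 (normalize_at z0 g) (normalize_at z0 h)"
    unfolding isometric_pair_def
    using d z0 gh[unfolded isometric_pair_def] Moebius_function_norm_lt_1[of "- z0"]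
    by (simp add: disk_map_normalize_at metric_ratio_normalize_at)
qed (simp_all add: normalize_at_def Moebius_function_eq_zero)

lemma metric_ratio_eq_deriv_normalize_at:
  assumes "disk_map g" "norm z0 < 1"
  shows "metric_ratio g z0 = (cmod (deriv (normalize_at z0 g) 0))\<^sup>2"
  using metric_ratio_normalize_at[OF assms, of 0] metric_ratio_zero[of "normalize_at z0 g"]
  by (simp add: normalize_at_def Moebius_function_eq_zero)

lemma congruent_pair_normalize_at:
  assumes g: "disk_map g" and h: "disk_map h" and z0: "norm z0 < 1"
  shows "congruent_pair g h (normalize_at z0 g) (normalize_at z0 h)"
proof (rule congruent_pair_sym)
  have w: "norm (g z0) < 1" "norm (h z0) < 1" "norm (- z0) < 1"
    using disk_map_norm[OF g] disk_map_norm[OF h] z0 by auto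
  show "congruent_pair (normalize_at z0 g) (normalize_at z0 h) g h"
    unfolding congruent_pair_def normalize_at_def
    using w[THEN Aut_disk_Moebius] by blast
qed (use g h in auto)

subsection \<open>The square root embedding and the classification\<close>

lemma cayley_upper_half_plane:
  assumes "Im \<tau> > 0"
  shows "(cayley has_field_derivative 2 * \<i> / (\<tau> + \<i>)\<^sup>2) (at \<tau>)"
    and "1 - (cmod (cayley \<tau>))\<^sup>2 = 4 * Im \<tau> / (cmod (\<tau> + \<i>))\<^sup>2"
    and "\<tau> + \<i> \<noteq> 0"
proof -
  show nz: "\<tau> + \<i> \<noteq> 0"
    using assms by (auto simp: complex_eq_iff)
  then show "(cayley has_field_derivative 2 * \<i> / (\<tau> + \<i>)\<^sup>2) (at \<tau>)"
    unfolding cayley_def[abs_def]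
    by (auto intro!: derivative_eq_intros simp: field_simps power2_eq_square)
  have "(cmod (\<tau> + \<i>))\<^sup>2 - (cmod (\<tau> - \<i>))\<^sup>2 = 4 * Im \<tau>"
    unfolding cmod_power2 by (simp add: power2_eq_square algebra_simps)
  moreover have "(cmod (cayley \<tau>))\<^sup>2 = (cmod (\<tau> - \<i>))\<^sup>2 / (cmod (\<tau> + \<i>))\<^sup>2"
    unfolding cayley_def norm_divide power_divide ..
  then have "1 - (cmod (cayley \<tau>))\<^sup>2 =
      ((cmod (\<tau> + \<i>))\<^sup>2 - (cmod (\<tau> - \<i>))\<^sup>2) / (cmod (\<tau> + \<i>))\<^sup>2"
    using nz by (simp add: field_simps)
  ultimately show "1 - (cmod (cayley \<tau>))\<^sup>2 = 4 * Im \<tau> / (cmod (\<tau> + \<i>))\<^sup>2"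
    by simp
qed

lemma norm_cayley_less_1:
  assumes "Im \<tau> > 0"
  shows "norm (cayley \<tau>) < 1"
proof -
  have "1 - (cmod (cayley \<tau>))\<^sup>2 > 0"
    using cayley_upper_half_plane[OF assms] assms by simp
  then show ?thesis
    by (simp add: abs_square_less_1)
qed

lemma inverse_cayley_disk:
  assumes "norm z < 1"
  shows "(inverse_cayley has_field_derivative 2 * \<i> / (1 - z)\<^sup>2) (at z)"
    and "1 - (cmod z)\<^sup>2 = Im (inverse_cayley z) * (cmod (1 - z))\<^sup>2"
    and "Im (inverse_cayley z) > 0" and "1 - z \<noteq> 0"
proof -
  show nz: "1 - z \<noteq> 0"
    using assms by auto
  then show "(inverse_cayley has_field_derivative 2 * \<i> / (1 - z)\<^sup>2) (at z)"
    unfolding inverse_cayley_def[abs_def]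
    by (auto intro!: derivative_eq_intros simp: field_simps power2_eq_square)
  have "cnj (1 - z) \<noteq> 0"
    using nz by (metis complex_cnj_zero_iff)
  then have "inverse_cayley z = \<i> * (1 + z) * cnj (1 - z) / of_real ((cmod (1 - z))\<^sup>2)"
    unfolding inverse_cayley_def complex_norm_square
    by (rule mult_divide_mult_cancel_right[symmetric])
  then have "Im (inverse_cayley z) = Im (\<i> * (1 + z) * cnj (1 - z)) / (cmod (1 - z))\<^sup>2"
    by (simp only: Im_divide_of_real)
  moreover have "Im (\<i> * (1 + z) * cnj (1 - z)) = 1 - (cmod z)\<^sup>2"
    unfolding cmod_power2 by (simp add: power2_eq_square algebra_simps)
  ultimately show eq: "1 - (cmod z)\<^sup>2 = Im (inverse_cayley z) * (cmod (1 - z))\<^sup>2"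
    using nz by simp
  have "1 - (cmod z)\<^sup>2 > 0"
    using norm_sq_less_1[OF assms] by simp
  then show "Im (inverse_cayley z) > 0"
    using nz unfolding eq by (simp add: zero_less_mult_iff)
qed

lemma inverse_cayley_cayley:
  assumes "Im \<tau> > 0"
  shows "inverse_cayley (cayley \<tau>) = \<tau>"
proof -
  have nz: "\<tau> + \<i> \<noteq> 0"
    by (rule cayley_upper_half_plane[OF assms])
  have "1 + cayley \<tau> = 2 * \<tau> / (\<tau> + \<i>)" "1 - cayley \<tau> = 2 * \<i> / (\<tau> + \<i>)"
    using nz by (simp_all add: cayley_def field_simps)
  then show ?thesis
    using nz by (simp add: inverse_cayley_def)
qed

lemma csqrt_upper_half_plane:
  assumes "Im \<tau> > 0"
  shows "Re (csqrt \<tau>) > 0" "Im (csqrt \<tau>) > 0" "Im \<tau> = 2 * Re (csqrt \<tau>) * Im (csqrt \<tau>)"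
proof -
  define w where "w = csqrt \<tau>"
  have "\<tau> = w\<^sup>2"
    by (simp add: w_def)
  then have eq: "Im \<tau> = 2 * Re w * Im w"
    by (simp add: power2_eq_square)
  have "Re w \<ge> 0"
    unfolding w_def by (rule Re_csqrt)
  moreover have "Re w * Im w > 0"
    using eq assms by (simp add: mult.commute)
  ultimately have "Re w > 0 \<and> Im w > 0"
    by (auto simp: zero_less_mult_iff)
  then show "Re (csqrt \<tau>) > 0" "Im (csqrt \<tau>) > 0" "Im \<tau> = 2 * Re (csqrt \<tau>) * Im (csqrt \<tau>)"
    using eq by (simp_all only: w_def)
qed

text \<open>The cases \<open>k = 1\<close> and \<open>k = \<i>\<close> are the two components.
  Square roots of points of the upper half-plane fill the first quadrant, which \<open>k\<close>
  must map into the upper half-plane. Measured with the density \<open>1 / Im\<close>, the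
  stretching factor is \<open>(1 / (2 |w|)) * (2 Re w Im w) / Im (k w)\<close>.\<close>

lemma cayley_csqrt:
  assumes k: "norm k = 1" and pos: "\<And>w. Re w > 0 \<Longrightarrow> Im w > 0 \<Longrightarrow> Im (k * w) > 0"
  defines "F \<equiv> \<lambda>z. cayley (k * csqrt (inverse_cayley z))"
  shows "disk_map F"
    and "norm z < 1 \<Longrightarrow> w = csqrt (inverse_cayley z) \<Longrightarrow>
           metric_ratio F z = (Re w * Im w / (cmod w * Im (k * w)))\<^sup>2"
proof -
  have kw: "Im (k * csqrt (inverse_cayley z)) > 0" if "norm z < 1" for z
    using csqrt_upper_half_plane[OF inverse_cayley_disk(3)[OF that]] pos by blast
  have D: "(F has_field_derivative 2 * \<i> / (k * csqrt (inverse_cayley z) + \<i>)\<^sup>2 *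
      (k * (inverse (2 * csqrt (inverse_cayley z)) * (2 * \<i> / (1 - z)\<^sup>2)))) (at z)"
    if z: "norm z < 1" for z
  proof -
    have "inverse_cayley z \<notin> \<real>\<^sub>\<le>\<^sub>0"
      using inverse_cayley_disk(3)[OF z] by (auto simp: complex_nonpos_Reals_iff)
    then have "(csqrt has_field_derivative inverse (2 * csqrt (inverse_cayley z))) (at (inverse_cayley z))"
      by (rule has_field_derivative_csqrt)
    then have "((\<lambda>z. k * csqrt (inverse_cayley z)) has_field_derivative
        k * (inverse (2 * csqrt (inverse_cayley z)) * (2 * \<i> / (1 - z)\<^sup>2))) (at z)"
      by (intro DERIV_cmult DERIV_chain2[where f = csqrt and g = inverse_cayley, OF _ inverse_cayley_disk(1)[OF z]])
    then show ?thesis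
      unfolding F_def by (rule DERIV_chain2[where f = cayley and g = "\<lambda>z. k * csqrt (inverse_cayley z)",
            OF cayley_upper_half_plane(1)[OF kw[OF z]]])
  qed
  have "F holomorphic_on unit_disk"
    unfolding holomorphic_on_open[OF open_ball] using D by (metis mem_ball_0)
  moreover have "norm (F z) < 1" if "norm z < 1" for z
    unfolding F_def by (rule norm_cayley_less_1[OF kw[OF that]])
  ultimately show "disk_map F"
    unfolding disk_map_def by auto
  assume z: "norm z < 1" and w: "w = csqrt (inverse_cayley z)"
  have w': "Re w > 0" "Im w > 0" "Im (inverse_cayley z) = 2 * Re w * Im w"
    unfolding w by (rule csqrt_upper_half_plane[OF inverse_cayley_disk(3)[OF z]])+
  then have "w \<noteq> 0" by auto
  have kw': "Im (k * w) > 0" "k * w + \<i> \<noteq> 0"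
    using kw[OF z] cayley_upper_half_plane(3)[OF kw[OF z]] by (simp_all add: w)
  have d: "cmod (deriv F z) = 2 / (cmod (k * w + \<i>))\<^sup>2 / cmod w / (cmod (1 - z))\<^sup>2"
    unfolding DERIV_imp_deriv[OF D[OF z]] w[symmetric]
    by (simp add: norm_mult norm_divide norm_inverse norm_power k field_simps)
  have n: "1 - (cmod (F z))\<^sup>2 = 4 * Im (k * w) / (cmod (k * w + \<i>))\<^sup>2"
    unfolding F_def w by (rule cayley_upper_half_plane(2)[OF kw[OF z]])
  have cancel: "2 / K\<^sup>2 / c / d\<^sup>2 * (2 * x * y * d\<^sup>2) / (4 * m / K\<^sup>2) = x * y / (c * m)"
    if "K \<noteq> 0" "c \<noteq> 0" "d \<noteq> 0" "m \<noteq> 0" for K c d m x y :: real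
    using that by (simp add: field_simps)
  have "cmod (deriv F z) * (1 - (cmod z)\<^sup>2) / (1 - (cmod (F z))\<^sup>2) = Re w * Im w / (cmod w * Im (k * w))"
    unfolding d n inverse_cayley_disk(2)[OF z] w'(3)
    using kw' \<open>w \<noteq> 0\<close> inverse_cayley_disk(4)[OF z] by (intro cancel) auto
  then show "metric_ratio F z = (Re w * Im w / (cmod w * Im (k * w)))\<^sup>2"
    unfolding metric_ratio_def by simp
qed

lemma square_root_embedding_components:
  "fst \<circ> square_root_embedding = (\<lambda>z. cayley (1 * csqrt (inverse_cayley z)))"
  "snd \<circ> square_root_embedding = (\<lambda>z. cayley (\<i> * csqrt (inverse_cayley z)))"
  by (simp_all add: square_root_embedding_def rho2_def fun_eq_iff)

text \<open>The two ratios are the squared cosine and sine of the argument of \<open>w\<close>. They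
  add up to 1, and each takes every value in (0, 1).\<close>

lemma metric_ratio_square_root_embedding:
  assumes "norm z < 1" and w: "w = csqrt (inverse_cayley z)"
  shows "metric_ratio (fst \<circ> square_root_embedding) z = (Re w)\<^sup>2 / (cmod w)\<^sup>2"
    and "metric_ratio (snd \<circ> square_root_embedding) z = (Im w)\<^sup>2 / (cmod w)\<^sup>2"
proof -
  have w': "Re w > 0" "Im w > 0"
    unfolding w by (rule csqrt_upper_half_plane[OF inverse_cayley_disk(3)[OF assms(1)]])+
  have "metric_ratio (fst \<circ> square_root_embedding) z = (Re w * Im w / (cmod w * Im (1 * w)))\<^sup>2"
    unfolding square_root_embedding_components by (rule cayley_csqrt(2)[OF _ _ assms]) simp_all
  then show "metric_ratio (fst \<circ> square_root_embedding) z = (Re w)\<^sup>2 / (cmod w)\<^sup>2"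
    using w' by (simp add: power_divide power_mult_distrib)
  have "metric_ratio (snd \<circ> square_root_embedding) z = (Re w * Im w / (cmod w * Im (\<i> * w)))\<^sup>2"
    unfolding square_root_embedding_components by (rule cayley_csqrt(2)[OF _ _ assms]) simp_all
  then show "metric_ratio (snd \<circ> square_root_embedding) z = (Im w)\<^sup>2 / (cmod w)\<^sup>2"
    using w' by (simp add: power_divide power_mult_distrib)
qed

lemma isometric_pair_square_root_embedding:
  "isometric_pair 1 1 (fst \<circ> square_root_embedding) (snd \<circ> square_root_embedding)"
  unfolding isometric_pair_def
proof (intro conjI allI impI)
  show "disk_map (fst \<circ> square_root_embedding)" "disk_map (snd \<circ> square_root_embedding)"
    unfolding square_root_embedding_components by (rule cayley_csqrt; simp)+
  fix z :: complex assume z: "norm z < 1"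
  define w where "w = csqrt (inverse_cayley z)"
  have "Re w > 0"
    unfolding w_def by (rule csqrt_upper_half_plane[OF inverse_cayley_disk(3)[OF z]])
  then have "(cmod w)\<^sup>2 \<noteq> 0" by auto
  then show "1 * metric_ratio (fst \<circ> square_root_embedding) z + 1 * metric_ratio (snd \<circ> square_root_embedding) z = 1"
    unfolding metric_ratio_square_root_embedding[OF z w_def] mult_1 add_divide_distrib[symmetric]
      cmod_power2[symmetric] by simp
qed

lemma square_root_embedding_attains_ratio:
  assumes "0 < A" "A < 1"
  obtains z where "norm z < 1" "metric_ratio (fst \<circ> square_root_embedding) z = A"
proof -
  \<comment> \<open>The point of the unit circle in the first quadrant whose squared cosine is
    \<open>A\<close>; its square is the corresponding point of the upper half-plane.\<close>
  define w where "w = Complex (sqrt A) (sqrt (1 - A))"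
  have w: "csqrt (w\<^sup>2) = w"
    using assms by (intro csqrt_square) (simp add: w_def)
  have "Im (w\<^sup>2) > 0"
    using assms by (simp add: w_def power2_eq_square)
  note \<tau> = norm_cayley_less_1[OF this] inverse_cayley_cayley[OF this]
  have "(cmod w)\<^sup>2 = 1" "(Re w)\<^sup>2 = A"
    using assms by (simp_all add: w_def cmod_power2)
  then have "metric_ratio (fst \<circ> square_root_embedding) (cayley (w\<^sup>2)) = A"
    using metric_ratio_square_root_embedding(1)[OF \<tau>(1), of w] \<tau>(2) w by simp
  then show ?thesis
    using that \<tau>(1) by blast
qed

section \<open>The classification\<close>

text \<open>If the ratio of \<open>g\<close> is constantly \<open>p\<close>, then \<open>g\<close>
  with weight \<open>1 / p\<close> and \<open>h\<close> with weight 0 again form an isometric pair.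
  For these weights the second Taylor relation reduces to \<open>a2 * cnj a1 = 0\<close>.\<close>

lemma normalized_pair_constant_ratio:
  assumes gh: "normalized_pair l1 l2 g h" and a1: "deriv g 0 \<noteq> 0"
    and const: "\<And>z. norm z < 1 \<Longrightarrow> metric_ratio g z = metric_ratio g 0"
  shows "deriv (deriv g) 0 = 0"
proof -
  interpret gh: normalized_pair l1 l2 g h by fact
  define p where "p = (cmod (deriv g 0))\<^sup>2"
  have p: "p \<noteq> 0" "metric_ratio g 0 = p"
    using a1 metric_ratio_zero[of g] gh.g_0 by (auto simp: p_def)
  have "(1 / p) * metric_ratio g z + 0 * metric_ratio h z = 1" if "norm z < 1" for z
    using const[OF that] p by simp
  then have "isometric_pair (1 / p) 0 g h"
    unfolding isometric_pair_def using gh.disk_map_g gh.disk_map_h by blast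
  then have "normalized_pair (1 / p) 0 g h"
    by (intro normalized_pair.intro gh.g_0 gh.h_0)
  note normalized_pair.taylor_relations(2)[OF this]
  then show ?thesis
    using a1 p(1) by simp
qed

lemma deriv_rotation:
  assumes "disk_map f" "norm c = 1"
  shows "deriv (\<lambda>z. f (c * z)) 0 = c * deriv f 0"
    and "deriv (deriv (\<lambda>z. f (c * z))) 0 = c\<^sup>2 * deriv (deriv f) 0"
  using higher_deriv_compose_linear[of f unit_disk unit_disk 0 c 1]
    higher_deriv_compose_linear[of f unit_disk unit_disk 0 c 2] assms
  by (simp_all add: disk_map_def norm_mult numeral_2_eq_2)

text \<open>The identity of lemma \<open>second_deriv_nonzero\<close>, with \<open>m = 1 / l1\<close>, \<open>n = 1 / l2\<close> and \<open>x = l1 p\<close>;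
  it is polynomial in \<open>x\<close>, hence also holds at \<open>x = 0\<close> and \<open>x = 1\<close>.\<close>

lemma weights_from_polynomial_identity:
  fixes X :: "real set"
  assumes inf: "infinite X" and pos: "m > 0" "n > 0"
    and eq: "\<And>x. x \<in> X \<Longrightarrow> 3 * x * (1 - x) * (m * x - n * (1 - x))\<^sup>2
      + 3 * (1 - m * x\<^sup>2 - n * (1 - x)\<^sup>2) * (m + n) * x * (1 - x) + m\<^sup>2 * x^3 + n\<^sup>2 * (1 - x)^3 = 1"
  shows "m = 1 \<and> n = 1"
proof -
  let ?x = "[:0, 1:] :: real poly" and ?y = "[:1, - 1:] :: real poly"
  define P where "P = 3 * ?x * ?y * (smult m ?x - smult n ?y)\<^sup>2
      + 3 * (1 - smult m (?x\<^sup>2) - smult n (?y\<^sup>2)) * [:m + n:] * ?x * ?y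
      + smult (m\<^sup>2) (?x^3) + smult (n\<^sup>2) (?y^3) - 1"
  have P: "poly P x = 3 * x * (1 - x) * (m * x - n * (1 - x))\<^sup>2
      + 3 * (1 - m * x\<^sup>2 - n * (1 - x)\<^sup>2) * (m + n) * x * (1 - x) + m\<^sup>2 * x^3 + n\<^sup>2 * (1 - x)^3 - 1" for x
    by (simp add: P_def) (simp add: algebra_simps power2_eq_square)
  have "X \<subseteq> {x. poly P x = 0}"
    using eq P by auto
  then have "P = 0"
    using inf poly_roots_finite finite_subset by blast
  \<comment> \<open>At 0 and 1 every term with the factor \<open>x * (1 - x)\<close> drops out,
    leaving \<open>n\<^sup>2 - 1\<close> and \<open>m\<^sup>2 - 1\<close>.\<close>
  then have "poly P 0 = 0" "poly P 1 = 0"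
    by simp_all
  then have "n\<^sup>2 = 1" "m\<^sup>2 = 1"
    unfolding P by simp_all
  then show ?thesis
    using pos by (simp add: power2_eq_1_iff)
qed

lemma isometric_pair_classification:
  assumes gh: "isometric_pair l1 l2 g h" and pos: "l1 > 0" "l2 > 0"
  shows "(l1 = 1 \<and> congruent_pair g h (\<lambda>z. z) (\<lambda>z. 0)) \<or>
         (l2 = 1 \<and> congruent_pair g h (\<lambda>z. 0) (\<lambda>z. z)) \<or>
         (l1 + l2 = 1 \<and> congruent_pair g h (\<lambda>z. z) (\<lambda>z. z)) \<or>
         (l1 = 1 \<and> l2 = 1 \<and> congruent_pair g h (fst \<circ> square_root_embedding) (snd \<circ> square_root_embedding))"
proof -
  have d: "disk_map g" "disk_map h"
    using gh unfolding isometric_pair_def by auto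
  have id: "(\<lambda>z. z) \<in> Aut_disk"
    using Aut_disk_rotation[of 1] by simp
  have lin: "congruent_pair g h G H"
    if "norm z0 < 1" "norm \<alpha> = 1" "norm \<beta> = 1"
      "\<And>z. norm z < 1 \<Longrightarrow> normalize_at z0 g z = \<alpha> * G z \<and> normalize_at z0 h z = \<beta> * H z" for z0 \<alpha> \<beta> G H
  proof (rule congruent_pair_trans[OF congruent_pair_normalize_at[OF d that(1)]])
    show "congruent_pair (normalize_at z0 g) (normalize_at z0 h) G H"
      unfolding congruent_pair_def
      using id Aut_disk_rotation[OF that(2)] Aut_disk_rotation[OF that(3)] that(4)
      by (intro bexI[of _ "\<lambda>z. z"] bexI[of _ "\<lambda>z. \<alpha> * z"] bexI[of _ "\<lambda>z. \<beta> * z"]) auto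
  qed
  let ?G = "\<lambda>z0. normalize_at z0 g" and ?H = "\<lambda>z0. normalize_at z0 h"
  show ?thesis
  \<comment> \<open>Either some base point is degenerate, which settles the first three cases, or
    the generic identity holds at all base points.\<close>
  proof (cases "\<exists>z0. norm z0 < 1 \<and> (deriv (?G z0) 0 = 0 \<or> deriv (?H z0) 0 = 0 \<or> deriv (deriv (?G z0)) 0 = 0)")
    case True
    then obtain z0 where z0: "norm z0 < 1"
      and cases: "deriv (?G z0) 0 = 0 \<or> deriv (?H z0) 0 = 0 \<or> deriv (deriv (?G z0)) 0 = 0"
      by blast
    have GH: "normalized_pair l1 l2 (?G z0) (?H z0)" "normalized_pair l2 l1 (?H z0) (?G z0)"
      using normalized_pair_normalize_at[OF gh z0]
        normalized_pair_normalize_at[OF gh[unfolded isometric_pair_commute[of l1 l2]] z0] by auto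
    consider "deriv (?H z0) 0 = 0" | "deriv (?G z0) 0 = 0"
      | "deriv (?G z0) 0 \<noteq> 0" "deriv (?H z0) 0 \<noteq> 0" "deriv (deriv (?G z0)) 0 = 0"
      using cases by blast
    then show ?thesis
    proof cases
      case 1
      obtain \<alpha> where "l1 = 1" "norm \<alpha> = 1" "\<And>z. norm z < 1 \<Longrightarrow> ?G z0 z = \<alpha> * z \<and> ?H z0 z = 0"
        using normalized_pair.deriv_h_zero[OF GH(1) pos 1] by blast
      then have "l1 = 1 \<and> congruent_pair g h (\<lambda>z. z) (\<lambda>z. 0)"
        using lin[OF z0, of \<alpha> 1 "\<lambda>z. z" "\<lambda>z. 0"] by simp
      then show ?thesis by blast
    next
      case 2
      obtain \<alpha> where "l2 = 1" "norm \<alpha> = 1" "\<And>z. norm z < 1 \<Longrightarrow> ?H z0 z = \<alpha> * z \<and> ?G z0 z = 0"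
        using normalized_pair.deriv_h_zero[OF GH(2) pos(2,1) 2] by blast
      then have "l2 = 1 \<and> congruent_pair g h (\<lambda>z. 0) (\<lambda>z. z)"
        using lin[OF z0, of 1 \<alpha> "\<lambda>z. 0" "\<lambda>z. z"] by simp
      then show ?thesis by blast
    next
      case 3
      obtain \<alpha> \<beta> where "l1 + l2 = 1" "norm \<alpha> = 1" "norm \<beta> = 1"
        "\<And>z. norm z < 1 \<Longrightarrow> ?G z0 z = \<alpha> * z \<and> ?H z0 z = \<beta> * z"
        using normalized_pair.second_deriv_zero[OF GH(1) pos 3] by blast
      then have "l1 + l2 = 1 \<and> congruent_pair g h (\<lambda>z. z) (\<lambda>z. z)"
        using lin[OF z0, of \<alpha> \<beta> "\<lambda>z. z" "\<lambda>z. z"] by simp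
      then show ?thesis by blast
    qed
  next
    case False
    then have nz: "deriv (?G z) 0 \<noteq> 0" "deriv (?H z) 0 \<noteq> 0" "deriv (deriv (?G z)) 0 \<noteq> 0" if "norm z < 1" for z
      using that by blast+
    define x where "x z = l1 * metric_ratio g z" for z
    \<comment> \<open>A finite connected image is a single point; the ratio of \<open>g\<close>
      would be constant, against the nonvanishing second derivative.\<close>
    have inf: "infinite (x ` unit_disk)"
    proof
      assume fin: "finite (x ` unit_disk)"
      have "connected (x ` unit_disk)"
        unfolding x_def
        by (intro connected_continuous_image continuous_intros continuous_on_ratio d connected_ball)
      then obtain a where "x ` unit_disk = {a}"
        using fin connected_finite_iff_sing by fastforce
      then have "x z = a" if "norm z < 1" for z
        using that by (metis image_eqI mem_ball_0 singletonD)
      then have c: "metric_ratio g z = a / l1" if "norm z < 1" for z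
        using that pos by (simp add: x_def field_simps)
      have "metric_ratio (?G 0) z = a / l1" if "norm z < 1" for z
        using that metric_ratio_normalize_at[OF d(1) _ that, of 0] c Moebius_function_norm_lt_1[of "- 0" z 0] by simp
      then have "deriv (deriv (?G 0)) 0 = 0"
        using nz(1)[of 0]
        by (intro normalized_pair_constant_ratio[OF normalized_pair_normalize_at[OF gh]]) auto
      then show False
        using nz(3)[of 0] by simp
    qed
    have "1 / l1 = 1 \<and> 1 / l2 = 1"
    proof (rule weights_from_polynomial_identity[OF inf])
      \<comment> \<open>The value \<open>t\<close> at \<open>z\<close> is \<open>l1 * p\<close> for
        the pair normalized at \<open>z\<close>, and \<open>1 - t\<close> is \<open>l2 * q\<close>;
        so \<open>second_deriv_nonzero\<close> at \<open>z\<close> becomes an identity in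
        \<open>t\<close>.\<close>
      fix t assume "t \<in> x ` unit_disk"
      then obtain z where z: "norm z < 1" "t = x z" by auto
      define p q where "p = (cmod (deriv (?G z) 0))\<^sup>2" and "q = (cmod (deriv (?H z) 0))\<^sup>2"
      have t: "t = l1 * p"
        using z metric_ratio_eq_deriv_normalize_at[OF d(1)] by (simp add: x_def p_def)
      have GH: "normalized_pair l1 l2 (?G z) (?H z)"
        by (rule normalized_pair_normalize_at[OF gh z(1)])
      have t': "1 - t = l2 * q"
        using normalized_pair.taylor_relations(1)[OF GH] by (simp add: t p_def q_def)
      have pt: "p = 1 / l1 * t" "q = 1 / l2 * (1 - t)"
        using t t' pos by (simp_all add: field_simps)
      have "l1 * p\<^sup>2 = 1 / l1 * t\<^sup>2" "l1 * p^3 = (1 / l1)\<^sup>2 * t^3"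
        "l2 * q\<^sup>2 = 1 / l2 * (1 - t)\<^sup>2" "l2 * q^3 = (1 / l2)\<^sup>2 * (1 - t)^3"
        unfolding pt using pos by (simp_all add: power2_eq_square power3_eq_cube)
      note powers = this
      have "3 * t * (1 - t) * (p - q)\<^sup>2 + 3 * (1 - l1 * p\<^sup>2 - l2 * q\<^sup>2) * (p * (1 - t) + q * t)
          + l1 * p^3 + l2 * q^3 = 1"
        using normalized_pair.second_deriv_nonzero[OF GH pos nz[OF z(1)]]
        unfolding p_def[symmetric] q_def[symmetric] t[symmetric] t'[symmetric] .
      moreover have "p * (1 - t) + q * t = (1 / l1 + 1 / l2) * t * (1 - t)"
        unfolding pt by (simp add: algebra_simps)
      ultimately show "3 * t * (1 - t) * (1 / l1 * t - 1 / l2 * (1 - t))\<^sup>2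
        + 3 * (1 - 1 / l1 * t\<^sup>2 - 1 / l2 * (1 - t)\<^sup>2) * (1 / l1 + 1 / l2) * t * (1 - t)
        + (1 / l1)\<^sup>2 * t^3 + (1 / l2)\<^sup>2 * (1 - t)^3 = 1"
        unfolding powers pt[symmetric] by (simp only: mult.assoc)
    qed (use pos in auto)
    then have l: "l1 = 1" "l2 = 1"
      by simp_all
    have zero: "norm (0 :: complex) < 1" by simp
    let ?g = "?G 0" and ?h = "?H 0"
    have gh0: "normalized_pair 1 1 ?g ?h"
      using normalized_pair_normalize_at[OF gh zero] l by simp
    define A where "A = (cmod (deriv ?g 0))\<^sup>2"
    have B: "(cmod (deriv ?h 0))\<^sup>2 = 1 - A"
      using normalized_pair.taylor_relations(1)[OF gh0] by (simp add: A_def)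
    have A: "0 < A" "A < 1"
      using nz(1,2)[OF zero] B by (simp add: A_def) (metis B diff_gt_0_iff_gt nz(2) zero zero_less_norm_iff zero_less_power)
    let ?S1 = "fst \<circ> square_root_embedding" and ?S2 = "snd \<circ> square_root_embedding"
    have S: "disk_map ?S1" "disk_map ?S2"
      using isometric_pair_square_root_embedding unfolding isometric_pair_def by auto
    \<comment> \<open>The base point of the square root embedding is chosen so that the first
      derivatives have equal moduli.\<close>
    obtain z1 where z1: "norm z1 < 1" "metric_ratio ?S1 z1 = A"
      using square_root_embedding_attains_ratio[OF A] .
    let ?G = "normalize_at z1 ?S1" and ?H = "normalize_at z1 ?S2"
    have GH: "normalized_pair 1 1 ?G ?H"
      by (rule normalized_pair_normalize_at[OF isometric_pair_square_root_embedding z1(1)])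
    have A': "(cmod (deriv ?G 0))\<^sup>2 = A"
      using metric_ratio_eq_deriv_normalize_at[OF S(1) z1(1)] z1(2) by simp
    then have B': "(cmod (deriv ?H 0))\<^sup>2 = 1 - A"
      using normalized_pair.taylor_relations(1)[OF GH] by simp
    define s S where "s = deriv (deriv ?g) 0 * cnj (deriv ?g 0)" and "S = deriv (deriv ?G) 0 * cnj (deriv ?G 0)"
    have "deriv ?G 0 \<noteq> 0" "deriv ?H 0 \<noteq> 0"
      using A A' B' by auto
    \<comment> \<open>For weights 1 the squared modulus is \<open>2 A B (1 - A^2 - B^2)\<close> with
      \<open>B = 1 - A\<close>, the same for both pairs.\<close>
    then have "(cmod S)\<^sup>2 = (cmod s)\<^sup>2"
      using normalized_pair.nonzero_relations(1)[OF gh0 _ _ nz(1,2)[OF zero]]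
        normalized_pair.nonzero_relations(1)[OF GH]
      unfolding s_def S_def A_def[symmetric] B A' B' by simp
    then have sS: "cmod S = cmod s"
      by (metis norm_ge_zero power2_eq_iff_nonneg)
    have "s \<noteq> 0"
      using nz[OF zero] by (simp add: s_def)
    \<comment> \<open>Precomposing with the rotation by \<open>c\<close> multiplies \<open>S\<close>
      by \<open>c\<^sup>2 * cnj c = c\<close>, so this choice aligns the arguments of
      \<open>S\<close> and \<open>s\<close>.\<close>
    define c where "c = s / S"
    have c: "norm c = 1" "c * S = s"
      using sS \<open>s \<noteq> 0\<close> by (auto simp: c_def norm_divide)
    have "c \<noteq> 0" using c by auto
    have cc: "c * cnj c = 1"
      using c(1) complex_norm_square[of c] by simp
    note GH' = normalized_pair.isometric[OF GH] normalized_pair.g_0[OF GH] normalized_pair.h_0[OF GH]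
    have dG: "disk_map ?G"
      using disk_map_normalize_at[OF S(1) z1(1)] .
    have rot: "normalized_pair 1 1 (\<lambda>z. ?G (c * z)) (\<lambda>z. ?H (c * z))"
      using isometric_pair_comp[OF GH'(1) disk_map_rotation metric_ratio_rotation[OF c(1)]] c GH'(2,3)
      by (intro normalized_pair.intro) auto
    obtain \<alpha> \<beta> where \<alpha>\<beta>: "norm \<alpha> = 1" "norm \<beta> = 1"
      "\<And>z. norm z < 1 \<Longrightarrow> ?g z = \<alpha> * ?G (c * z) \<and> ?h z = \<beta> * ?H (c * z)"
    proof (rule normalized_pair_unique[OF gh0 rot nz[OF zero]])
      show "cmod (deriv (\<lambda>z. ?G (c * z)) 0) = cmod (deriv ?g 0)"
        using A' c(1) unfolding deriv_rotation[OF dG c(1)] A_def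
        by (simp add: norm_mult)
      have "c\<^sup>2 * deriv (deriv ?G) 0 * cnj (c * deriv ?G 0) = (c * cnj c) * (c * S)"
        by (simp add: S_def power2_eq_square)
      then show "deriv (deriv (\<lambda>z. ?G (c * z))) 0 * cnj (deriv (\<lambda>z. ?G (c * z)) 0) =
          deriv (deriv ?g) 0 * cnj (deriv ?g 0)"
        unfolding deriv_rotation[OF dG c(1)] cc c(2) by (simp add: s_def)
    qed blast
    have "congruent_pair ?g ?h ?G ?H"
      unfolding congruent_pair_def
      using Aut_disk_rotation[OF c(1)] Aut_disk_rotation[OF \<alpha>\<beta>(1)] Aut_disk_rotation[OF \<alpha>\<beta>(2)] \<alpha>\<beta>(3)
      by (intro bexI[of _ "\<lambda>z. c * z"] bexI[of _ "\<lambda>z. \<alpha> * z"] bexI[of _ "\<lambda>z. \<beta> * z"]) auto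
    \<comment> \<open>The chain runs from the given pair to its normalization at 0, to the
      normalization of the embedding at \<open>z1\<close>, and back to the embedding.\<close>
    then have "congruent_pair g h ?S1 ?S2"
      using congruent_pair_trans[OF congruent_pair_normalize_at[OF d zero]]
        congruent_pair_trans[OF _ congruent_pair_sym[OF congruent_pair_normalize_at[OF S z1(1)]]]
        disk_map_normalize_at[OF S(1) z1(1)] disk_map_normalize_at[OF S(2) z1(1)] by blast
    then show ?thesis
      using l by blast
  qed
qed

theorem theorem27:
  fixes l1 l2 :: real and f :: "complex \<Rightarrow> complex \<times> complex"
  assumes "l1 > 0" and "l2 > 0"
    and "holomorphic_isometry l1 l2 f"
  shows "(l1 = 1 \<and> congruent_isometries l1 l2 f (\<lambda>z. (z, 0))) \<or>
         (l2 = 1 \<and> congruent_isometries l1 l2 f (\<lambda>z. (0, z))) \<or>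
         (l1 + l2 = 1 \<and> congruent_isometries l1 l2 f (\<lambda>z. (z, z))) \<or>
         (l1 = 1 \<and> l2 = 1 \<and> congruent_isometries l1 l2 f square_root_embedding)"
proof -
  have iff: "holomorphic_isometry l1 l2 F \<longleftrightarrow> isometric_pair l1 l2 (fst \<circ> F) (snd \<circ> F)" for F
    unfolding holomorphic_isometry_iff isometric_pair_def by auto
  \<comment> \<open>\<open>congruent_isometries\<close> also demands that the model map be an
    isometry for the same weights, whence the first premise.\<close>
  have cong: "congruent_isometries l1 l2 f F"
    if "isometric_pair l1 l2 (fst \<circ> F) (snd \<circ> F)"
      "congruent_pair (fst \<circ> f) (snd \<circ> f) (fst \<circ> F) (snd \<circ> F)" for F
    using congruent_isometriesI assms(3) that iff by blast
  have zero: "disk_map (\<lambda>z. 0)" "\<And>z. metric_ratio (\<lambda>z. 0) z = 0"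
    by (auto simp: disk_map_def metric_ratio_def)
  have id: "disk_map (\<lambda>z. z)" "\<And>z. norm z < 1 \<Longrightarrow> metric_ratio (\<lambda>z. z) z = 1"
    using disk_map_rotation[of 1] metric_ratio_rotation[of 1] by simp_all
  have "isometric_pair l1 l2 (fst \<circ> f) (snd \<circ> f)"
    using assms(3) iff by blast
  from isometric_pair_classification[OF this assms(1,2)] show ?thesis
  proof (elim disjE conjE)
    assume "l1 = 1" "congruent_pair (fst \<circ> f) (snd \<circ> f) (\<lambda>z. z) (\<lambda>z. 0)"
    then have "congruent_isometries l1 l2 f (\<lambda>z. (z, 0))"
      using zero id by (intro cong) (simp_all add: isometric_pair_def o_def)
    then show ?thesis using \<open>l1 = 1\<close> by blast
  next
    assume "l2 = 1" "congruent_pair (fst \<circ> f) (snd \<circ> f) (\<lambda>z. 0) (\<lambda>z. z)"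
    then have "congruent_isometries l1 l2 f (\<lambda>z. (0, z))"
      using zero id by (intro cong) (simp_all add: isometric_pair_def o_def)
    then show ?thesis using \<open>l2 = 1\<close> by blast
  next
    assume "l1 + l2 = 1" "congruent_pair (fst \<circ> f) (snd \<circ> f) (\<lambda>z. z) (\<lambda>z. z)"
    then have "congruent_isometries l1 l2 f (\<lambda>z. (z, z))"
      using id by (intro cong) (simp_all add: isometric_pair_def o_def)
    then show ?thesis using \<open>l1 + l2 = 1\<close> by blast
  next
    assume "l1 = 1" "l2 = 1"
      "congruent_pair (fst \<circ> f) (snd \<circ> f) (fst \<circ> square_root_embedding) (snd \<circ> square_root_embedding)"
    then have "congruent_isometries l1 l2 f square_root_embedding"
      using isometric_pair_square_root_embedding by (intro cong) simp_all
    then show ?thesis using \<open>l1 = 1\<close> \<open>l2 = 1\<close> by blast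
  qed
qed

end
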